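(* For every prime power $q \geq 4$, the graph $H_q$ (which has $q^4-q^3+q^2$ vertices) is quasi-Folkman with distinguished family $\mathscr{T}_q$; that is, no four triangles in $\mathscr{T}_q$ induce a $K_4$ in $H_q$, and every two-coloring of $E(H_q)$ induces a monochromatic triangle belonging to $\mathscr{T}_q$. Moreover, as $q \to \infty$ (over prime powers), every two-coloring of $E(H_q)$ induces at least $(\tfrac14 - o(1))|\mathscr{T}_q|$ monochromatic triangles belonging to $\mathscr{T}_q$.
   Context: Let $q$ be a prime power and $PG(2,q^2)$ the projective plane over $\mathbb{F}_{q^2}$. The Hermitian unital is $\mathscr{U}_q = \{\langle X,Y,Z\rangle : X^{q+1}+Y^{q+1}+Z^{q+1}=0\}$, a set of points of $PG(2,q^2)$ (here $\langle X,Y,Z\rangle$ is the 1-dimensional subspace spanned by a nonzero vector of $\mathbb{F}_{q^2}^3$). Every line of $PG(2,q^2)$ meets $\mathscr{U}_q$ in exactly $1$ or exactly $q+1$ points; lines meeting it in $q+1$ points are called secants, and $\mathscr{L}_q$ denotes the set of secants. The graph $H_q$ has vertex set $\{v_\ell : \ell \in \mathscr{L}_q\}$, with $v_{\ell_1} \sim v_{\ell_2}$ iff $\ell_1 \neq \ell_2$ and $\ell_1 \cap \ell_2 \in \mathscr{U}_q$. A triangle $v_{\ell_1}v_{\ell_2}v_{\ell_3}$ of $H_q$ is non-degenerate if the three points $\ell_1\cap\ell_2$, $\ell_2\cap\ell_3$, $\ell_1\cap\ell_3$ (all in $\mathscr{U}_q$) are pairwise distinct; $\mathscr{T}_q$ is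 the set of non-degenerate triangles of $H_q$. A graph $G$ is quasi-Folkman if there is a family $\mathscr{T}$ of triangles of $G$ such that (1) no four triangles of $\mathscr{T}$ are the four triangles of a $K_4$ in $G$, and (2) every two-coloring of $E(G)$ has a monochromatic triangle in $\mathscr{T}$. *)

theory Defs
  imports Complex_Main "HOL-Computational_Algebra.Primes" "HOL-Algebra.Ring"
begin

definition is_prime_power :: "nat \<Rightarrow> bool" where
  "is_prime_power q \<longleftrightarrow> (\<exists>p k. prime p \<and> k \<ge> 1 \<and> q = p ^ k)"

definition nzvecs :: "('a, 'b) ring_scheme \<Rightarrow> ('a \<times> 'a \<times> 'a) set" where
  "nzvecs R = {(x, y, z). x \<in> carrier R \<and> y \<in> carrier R \<and> z \<in> carrier R \<and>
                  \<not> (x = \<zero>\<^bsub>R\<^esub> \<and> y = \<zero>\<^bsub>R\<^esub> \<and> z = \<zero>\<^bsub>R\<^esub>)}"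

definition pspan :: "('a, 'b) ring_scheme \<Rightarrow> 'a \<times> 'a \<times> 'a \<Rightarrow> ('a \<times> 'a \<times> 'a) set" where
  "pspan R v = (case v of (x, y, z) \<Rightarrow>
     {(c \<otimes>\<^bsub>R\<^esub> x, c \<otimes>\<^bsub>R\<^esub> y, c \<otimes>\<^bsub>R\<^esub> z) | c. c \<in> carrier R \<and> c \<noteq> \<zero>\<^bsub>R\<^esub>})"

definition ppoints :: "('a, 'b) ring_scheme \<Rightarrow> ('a \<times> 'a \<times> 'a) set set" where
  "ppoints R = pspan R ` nzvecs R"

definition pline :: "('a, 'b) ring_scheme \<Rightarrow> 'a \<times> 'a \<times> 'a \<Rightarrow> ('a \<times> 'a \<times> 'a) set set" where
  "pline R l = (case l of (a, b, c) \<Rightarrow>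
     {pspan R (x, y, z) | x y z. (x, y, z) \<in> nzvecs R \<and>
        (a \<otimes>\<^bsub>R\<^esub> x) \<oplus>\<^bsub>R\<^esub> (b \<otimes>\<^bsub>R\<^esub> y) \<oplus>\<^bsub>R\<^esub> (c \<otimes>\<^bsub>R\<^esub> z) = \<zero>\<^bsub>R\<^esub>})"

definition plines :: "('a, 'b) ring_scheme \<Rightarrow> ('a \<times> 'a \<times> 'a) set set set" where
  "plines R = pline R ` nzvecs R"

section \<open>Hermitian unital in PG(2,q^2) and its secants\<close>

definition hunital :: "('a, 'b) ring_scheme \<Rightarrow> nat \<Rightarrow> ('a \<times> 'a \<times> 'a) set set" where
  "hunital R q = {pspan R (x, y, z) | x y z. (x, y, z) \<in> nzvecs R \<and>
      (x [^]\<^bsub>R\<^esub> (q + 1)) \<oplus>\<^bsub>R\<^esub> (y [^]\<^bsub>R\<^esub> (q + 1)) \<oplus>\<^bsub>R\<^esub> (z [^]\<^bsub>R\<^esub> (q + 1)) = \<zero>\<^bsub>R\<^esub>}"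

definition secants :: "('a, 'b) ring_scheme \<Rightarrow> nat \<Rightarrow> ('a \<times> 'a \<times> 'a) set set set" where
  "secants R q = {l \<in> plines R. card (l \<inter> hunital R q) = q + 1}"

definition meet :: "('a \<times> 'a \<times> 'a) set set \<Rightarrow> ('a \<times> 'a \<times> 'a) set set \<Rightarrow> ('a \<times> 'a \<times> 'a) set" where
  "meet l1 l2 = the_elem (l1 \<inter> l2)"

text \<open>Adjacency of the graph H_q (on vertex set secants R q).\<close>
definition Hadj :: "('a, 'b) ring_scheme \<Rightarrow> nat \<Rightarrow> ('a \<times> 'a \<times> 'a) set set \<Rightarrow> ('a \<times> 'a \<times> 'a) set set \<Rightarrow> bool" where
  "Hadj R q l1 l2 \<longleftrightarrow> l1 \<noteq> l2 \<and> meet l1 l2 \<in> hunital R q"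

definition Htri :: "('a, 'b) ring_scheme \<Rightarrow> nat \<Rightarrow> ('a \<times> 'a \<times> 'a) set set set set" where
  "Htri R q = {{l1, l2, l3} | l1 l2 l3.
      l1 \<in> secants R q \<and> l2 \<in> secants R q \<and> l3 \<in> secants R q \<and>
      Hadj R q l1 l2 \<and> Hadj R q l2 l3 \<and> Hadj R q l1 l3 \<and>
      meet l1 l2 \<noteq> meet l2 l3 \<and> meet l1 l2 \<noteq> meet l1 l3 \<and> meet l2 l3 \<noteq> meet l1 l3}"

section \<open>Generic graph notions (graph = vertex set V with symmetric irreflexive adjacency adj)\<close>

definition is_triangle :: "'v set \<Rightarrow> ('v \<Rightarrow> 'v \<Rightarrow> bool) \<Rightarrow> 'v set \<Rightarrow> bool" where
  "is_triangle V adj t \<longleftrightarrow> (\<exists>a b c. t = {a, b, c} \<and> a \<in> V \<and> b \<in> V \<and> c \<in> V \<and>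
      adj a b \<and> adj b c \<and> adj a c \<and> a \<noteq> b \<and> b \<noteq> c \<and> a \<noteq> c)"

text \<open>A two-colouring of the edges is a function from 2-element vertex sets to bool;
  only its values on edges matter. A triangle is monochromatic if all its edges get the same colour.\<close>
definition monochromatic :: "('v set \<Rightarrow> bool) \<Rightarrow> 'v set \<Rightarrow> bool" where
  "monochromatic col t \<longleftrightarrow> (\<exists>c. \<forall>a\<in>t. \<forall>b\<in>t. a \<noteq> b \<longrightarrow> col {a, b} = c)"

definition quasi_folkman_with :: "'v set \<Rightarrow> ('v \<Rightarrow> 'v \<Rightarrow> bool) \<Rightarrow> 'v set set \<Rightarrow> bool" where
  "quasi_folkman_with V adj T \<longleftrightarrow>
     (\<forall>t\<in>T. is_triangle V adj t) \<and>
     \<not> (\<exists>a b c d. a \<in> V \<and> b \<in> V \<and> c \<in> V \<and> d \<in> V \<and> distinct [a, b, c, d] \<and>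
          adj a b \<and> adj a c \<and> adj a d \<and> adj b c \<and> adj b d \<and> adj c d \<and>
          {a, b, c} \<in> T \<and> {a, b, d} \<in> T \<and> {a, c, d} \<in> T \<and> {b, c, d} \<in> T) \<and>
     (\<forall>col :: 'v set \<Rightarrow> bool. \<exists>t\<in>T. monochromatic col t)"

end

theory Submission
  imports Defs "HOL-Algebra.Multiplicative_Group"
begin

text \<open>
  The points of the unital with the secants as blocks form a \<open>2-(q\<^sup>3 + 1, q + 1, 1)\<close> design, and the
  Ramsey statement holds in every Steiner system with blocks of size \<open>k\<close>. Fix a block \<open>l\<close> and a point \<open>X\<close> off
  \<open>l\<close>: the \<open>k\<close> blocks joining \<open>X\<close> to \<open>l\<close> span, in pairs, the non-degenerate triangles with side \<open>l\<close> and
  opposite vertex \<open>X\<close>, and at most \<open>k\<^sup>2 / 4\<close> of these \<open>k (k - 1) / 2\<close> pairs have differently coloured edges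
  to \<open>l\<close>. A non-monochromatic triangle has two sides at which its two edges differ in colour, a triangle has
  three sides, so the proportion of non-monochromatic triangles is at most \<open>3 k / (4 (k - 1))\<close>.

  Four non-degenerate triangles on a \<open>K\<^sub>4\<close> would be an O'Nan configuration: four secants meeting in
  six distinct points of the unital. Scale isotropic vectors \<open>u\<close>, \<open>v\<close>, \<open>w\<close> spanning the vertices of
  the triangle cut out by three of the secants so that the fourth one meets the sides in the spans of
  \<open>u - v\<close>, \<open>v - w\<close>, \<open>w - u\<close>. Isotropy of the differences makes the \<open>3 \<times> 3\<close> Gram matrix alternating,
  hence singular, although the form is non-degenerate.
\<close>

section \<open>Two-colourings of pairs\<close>

lemma card_split_pairs_le:
  fixes f :: "'a \<Rightarrow> bool"
  assumes "finite A"
  shows "4 * card {p. p \<subseteq> A \<and> card p = 2 \<and> (\<exists>x\<in>p. \<exists>y\<in>p. f x \<noteq> f y)} \<le> (card A)\<^sup>2"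
    (is "4 * card ?split \<le> _")
proof -
  let ?B = "{x \<in> A. f x}" and ?C = "{x \<in> A. \<not> f x}"
  have "?split \<subseteq> (\<lambda>(x, y). {x, y}) ` (?B \<times> ?C)"
    by (auto simp: card_2_iff image_iff)
  then have "card ?split \<le> card (?B \<times> ?C)"
    using assms by (intro surj_card_le) auto
  also have "\<dots> = card ?B * card ?C"
    by (rule card_cartesian_product)
  finally have "4 * card ?split \<le> 4 * (card ?B * card ?C)"
    by simp
  also have "\<dots> \<le> (card ?B + card ?C)\<^sup>2"
  proof -
    have "0 \<le> (int (card ?B) - int (card ?C))\<^sup>2" by simp
    then have "int (4 * (card ?B * card ?C)) \<le> int ((card ?B + card ?C)\<^sup>2)"
      by (simp add: power2_eq_square algebra_simps)
    then show ?thesis by (simp only: of_nat_le_iff)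
  qed
  also have "card ?B + card ?C = card (?B \<union> ?C)"
    using assms by (intro card_Un_disjoint[symmetric]) auto
  also have "?B \<union> ?C = A" by blast
  finally show ?thesis .
qed

definition bichromatic_at :: "('v set \<Rightarrow> bool) \<Rightarrow> 'v \<Rightarrow> 'v set \<Rightarrow> bool" where
  "bichromatic_at col l t \<longleftrightarrow> (\<exists>m\<in>t - {l}. \<exists>n\<in>t - {l}. col {l, m} \<noteq> col {l, n})"

lemma monochromatic_if_not_bichromatic_at:
  assumes "card t = 3" "a \<in> t" "b \<in> t" "a \<noteq> b" "\<not> bichromatic_at col a t" "\<not> bichromatic_at col b t"
  shows "monochromatic col t"
proof -
  have "card (t - {a, b}) = 1"
    using assms(1-4) by (simp add: card_Diff_subset)
  then obtain c where "t - {a, b} = {c}"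
    by (rule card_1_singletonE)
  then have t: "t = {a, b, c}" and "c \<noteq> a" "c \<noteq> b"
    using assms(2,3) by auto
  then have "b \<in> t - {a}" "c \<in> t - {a}" "a \<in> t - {b}" "c \<in> t - {b}"
    using assms(4) by auto
  then have "col {a, b} = col {a, c}" "col {b, a} = col {b, c}"
    using assms(5,6) unfolding bichromatic_at_def by blast+
  then have "\<forall>x\<in>{a, b, c}. \<forall>y\<in>{a, b, c}. x \<noteq> y \<longrightarrow> col {x, y} = col {a, b}"
    by (simp add: doubleton_eq_iff insert_commute[of b a] insert_commute[of c])
  then show ?thesis
    unfolding monochromatic_def t by blast
qed

lemma two_le_card_bichromatic_at:
  assumes "card t = 3" "\<not> monochromatic col t"
  shows "2 \<le> card {l \<in> t. bichromatic_at col l t}"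
proof -
  have "finite t" using assms(1) by (simp add: card_ge_0_finite)
  then have "card {l \<in> t. \<not> bichromatic_at col l t} \<le> 1"
    using monochromatic_if_not_bichromatic_at[OF assms(1)] assms(2)
    by (auto simp: card_le_Suc0_iff_eq)
  moreover have "card t = card {l \<in> t. bichromatic_at col l t} + card {l \<in> t. \<not> bichromatic_at col l t}"
    using \<open>finite t\<close> by (subst card_Int_Diff[of t "Collect (\<lambda>l. bichromatic_at col l t)"])
      (simp_all add: Collect_conj_eq set_diff_eq)
  ultimately show ?thesis using assms(1) by simp
qed

section \<open>Triangles of blocks in a Steiner system\<close>

text \<open>Blocks may have elements outside \<open>U\<close>: the blocks of the unital are full projective lines.\<close>

locale steiner_system =
  fixes U :: "'p set" and L :: "'p set set" and k :: nat
  assumes finite_points: "finite U"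
    and finite_blocks: "finite L"
    and card_block: "l \<in> L \<Longrightarrow> card (U \<inter> l) = k"
    and unique_join: "x \<in> U \<Longrightarrow> y \<in> U \<Longrightarrow> x \<noteq> y \<Longrightarrow> \<exists>!l. l \<in> L \<and> x \<in> l \<and> y \<in> l"
begin

definition join :: "'p \<Rightarrow> 'p \<Rightarrow> 'p set" where
  "join x y = (THE l. l \<in> L \<and> x \<in> l \<and> y \<in> l)"

lemma join:
  assumes "x \<in> U" "y \<in> U" "x \<noteq> y"
  shows "join x y \<in> L" "x \<in> join x y" "y \<in> join x y"
  using theI'[OF unique_join[OF assms]] unfolding join_def by blast+

lemma blocks_eqI:
  assumes "l \<in> L" "m \<in> L" "x \<in> U \<inter> l \<inter> m" "y \<in> U \<inter> l \<inter> m" "x \<noteq> y"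
  shows "l = m"
  using unique_join[of x y] assms by blast

lemma card_blocks: "card L * (k choose 2) = card U choose 2"
proof -
  let ?pairs = "\<lambda>A. {p. p \<subseteq> A \<and> card p = 2}"
  have "?pairs U = (\<Union>l\<in>L. ?pairs (U \<inter> l))"
  proof (intro equalityI subsetI)
    fix p assume "p \<in> ?pairs U"
    then obtain x y where "p = {x, y}" "x \<noteq> y" "x \<in> U" "y \<in> U"
      by (auto simp: card_2_iff)
    then show "p \<in> (\<Union>l\<in>L. ?pairs (U \<inter> l))"
      using join[of x y] by auto
  qed auto
  also have "card \<dots> = (\<Sum>l\<in>L. card (?pairs (U \<inter> l)))"
  proof (intro card_UN_disjoint ballI impI)
    fix l m assume lm: "l \<in> L" "m \<in> L" "l \<noteq> m"
    have False if "p \<in> ?pairs (U \<inter> l)" "p \<in> ?pairs (U \<inter> m)" for p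
    proof -
      obtain x y where "p = {x, y}" "x \<noteq> y"
        using \<open>p \<in> ?pairs (U \<inter> l)\<close> by (auto simp: card_2_iff)
      then show False
        using that lm blocks_eqI[of l m x y] by auto
    qed
    then show "?pairs (U \<inter> l) \<inter> ?pairs (U \<inter> m) = {}" by blast
  qed (use finite_blocks finite_points in auto)
  also have "\<dots> = (\<Sum>l\<in>L. card (U \<inter> l) choose 2)"
    using finite_points by (intro sum.cong n_subsets) auto
  also have "\<dots> = card L * (k choose 2)"
    by (simp add: card_block)
  finally show ?thesis
    using n_subsets[OF finite_points] by simp
qed

lemma card_points_off_block:
  assumes "l \<in> L"
  shows "card (U - l) = card U - k"
  using card_Diff_subset_Int[of U l] finite_points card_block[OF assms] by simp

definition pencil :: "'p set \<Rightarrow> 'p \<Rightarrow> 'p set set" where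
  "pencil l X = join X ` (U \<inter> l)"

lemma finite_pencil: "finite (pencil l X)"
  using finite_points by (simp add: pencil_def)

lemma mem_pencil_iff:
  assumes "X \<in> U - l"
  shows "m \<in> pencil l X \<longleftrightarrow> m \<in> L \<and> X \<in> m \<and> U \<inter> l \<inter> m \<noteq> {}"
proof
  assume "m \<in> pencil l X"
  then obtain A where "A \<in> U \<inter> l" "m = join X A" by (auto simp: pencil_def)
  then show "m \<in> L \<and> X \<in> m \<and> U \<inter> l \<inter> m \<noteq> {}"
    using join[of X A] assms by auto
next
  assume "m \<in> L \<and> X \<in> m \<and> U \<inter> l \<inter> m \<noteq> {}"
  then obtain A where "m \<in> L" "X \<in> m" "A \<in> U \<inter> l" "A \<in> m" by blast
  moreover from this have "m = join X A"
    using blocks_eqI[of m "join X A" X A] join[of X A] assms by auto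
  ultimately show "m \<in> pencil l X" by (simp add: pencil_def)
qed

lemma card_pencil:
  assumes "l \<in> L" "X \<in> U - l"
  shows "card (pencil l X) = k"
proof -
  have "inj_on (join X) (U \<inter> l)"
  proof (rule inj_onI)
    fix A B assume AB: "A \<in> U \<inter> l" "B \<in> U \<inter> l" "join X A = join X B"
    then have "join X A \<in> L" "X \<in> join X A" "A \<in> join X A" "B \<in> join X A"
      using join[of X A] join[of X B] assms by auto
    then show "A = B"
      using AB assms blocks_eqI[of l "join X A" A B] by auto
  qed
  then show ?thesis
    unfolding pencil_def using card_block[OF assms(1)] by (simp add: card_image)
qed

definition triangles :: "'p set set set" where
  "triangles = {t. t \<subseteq> L \<and> card t = 3 \<and> pairwise (\<lambda>l m. U \<inter> l \<inter> m \<noteq> {}) t \<and> U \<inter> \<Inter>t = {}}"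

lemma finite_triangles: "finite triangles"
  by (rule finite_subset[of _ "Pow L"]) (auto simp: triangles_def finite_blocks)

lemma triangleE:
  assumes "t \<in> triangles"
  obtains l m n where "t = {l, m, n}" "{l, m, n} \<in> triangles"
proof -
  have "card t = 3" using assms by (simp add: triangles_def)
  then obtain l m n where "t = {l, m, n}" unfolding card_3_iff by blast
  with assms that show ?thesis by blast
qed

lemma triple_in_triangles_iff:
  "{l, m, n} \<in> triangles \<longleftrightarrow>
    l \<in> L \<and> m \<in> L \<and> n \<in> L \<and> distinct [l, m, n] \<and>
    U \<inter> l \<inter> m \<noteq> {} \<and> U \<inter> m \<inter> n \<noteq> {} \<and> U \<inter> l \<inter> n \<noteq> {} \<and> U \<inter> l \<inter> m \<inter> n = {}"
proof (cases "distinct [l, m, n]")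
  case True
  then show ?thesis
    by (simp add: triangles_def pairwise_def Int_ac) blast
next
  case False
  then have "card {l, m, n} \<noteq> 3"
    by (simp add: card_insert_if) blast
  with False show ?thesis
    unfolding triangles_def by simp blast
qed

lemma insert_pencil_pair_in_triangles:
  assumes l: "l \<in> L" and X: "X \<in> U - l" and p: "p \<subseteq> pencil l X" "card p = 2"
  shows "insert l p \<in> triangles"
proof -
  obtain m n where mn: "p = {m, n}" "m \<noteq> n"
    using p(2) by (auto simp: card_2_iff)
  have m: "m \<in> L" "X \<in> m" "U \<inter> l \<inter> m \<noteq> {}" and n: "n \<in> L" "X \<in> n" "U \<inter> l \<inter> n \<noteq> {}"
    using p(1) mn(1) by (simp_all add: mem_pencil_iff[OF X])
  have "U \<inter> l \<inter> m \<inter> n = {}"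
    using blocks_eqI[OF m(1) n(1), of X] m(2) n(2) mn(2) X by auto
  then show ?thesis
    unfolding mn(1) triple_in_triangles_iff using l m n mn(2) X by auto
qed

lemma triangle_throughE:
  assumes "t \<in> triangles" "l \<in> t"
  obtains X p where "X \<in> U - l" "p \<subseteq> pencil l X" "card p = 2" "t = insert l p"
proof -
  have "card (t - {l}) = 2"
    using assms by (simp add: triangles_def card_Diff_singleton)
  then obtain m n where p: "t - {l} = {m, n}" "m \<noteq> n"
    unfolding card_2_iff by blast
  then have t: "t = {l, m, n}"
    using insert_Diff[OF assms(2)] by simp
  then have blocks: "m \<in> L" "n \<in> L"
    and meets: "U \<inter> l \<inter> m \<noteq> {}" "U \<inter> m \<inter> n \<noteq> {}" "U \<inter> l \<inter> n \<noteq> {}"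
    and not_concurrent: "U \<inter> l \<inter> m \<inter> n = {}"
    using assms(1) by (simp_all add: triple_in_triangles_iff)
  then obtain X where X: "X \<in> U" "X \<in> m" "X \<in> n" by blast
  then have "X \<in> U - l"
    using not_concurrent by blast
  moreover from this have "{m, n} \<subseteq> pencil l X"
    using blocks meets X by (simp add: mem_pencil_iff)
  ultimately show ?thesis
    using that[of X "{m, n}"] p(2) t by simp
qed

lemma inj_on_insert_pencil_pair:
  "inj_on (\<lambda>(X, p). insert l p) (SIGMA X:U - l. {p. p \<subseteq> pencil l X \<and> card p = 2})"
proof (rule inj_onI, clarify)
  fix X p Y r
  assume X: "X \<in> U" "X \<notin> l" "p \<subseteq> pencil l X" "card p = 2"
    and Y: "Y \<in> U" "Y \<notin> l" "r \<subseteq> pencil l Y" and eq: "insert l p = insert l r"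
  have "l \<notin> p" "l \<notin> r"
    using X Y mem_pencil_iff[of X l l] mem_pencil_iff[of Y l l] by auto
  with eq have "p = r"
    by (metis Diff_insert_absorb)
  obtain m n where "p = {m, n}" "m \<noteq> n"
    using X(4) by (auto simp: card_2_iff)
  then have "X = Y"
    using X Y \<open>p = r\<close> blocks_eqI[of m n X Y] mem_pencil_iff[of X l] mem_pencil_iff[of Y l] by auto
  with \<open>p = r\<close> show "X = Y \<and> p = r" by simp
qed

lemma card_triangles_through:
  assumes "l \<in> L"
  shows "card {t \<in> triangles. l \<in> t \<and> Q t} =
    (\<Sum>X\<in>U - l. card {p. p \<subseteq> pencil l X \<and> card p = 2 \<and> Q (insert l p)})"
proof -
  let ?S = "SIGMA X:U - l. {p. p \<subseteq> pencil l X \<and> card p = 2 \<and> Q (insert l p)}"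
  have "{t \<in> triangles. l \<in> t \<and> Q t} = (\<lambda>(X, p). insert l p) ` ?S"
    using insert_pencil_pair_in_triangles[OF assms] by (auto elim!: triangle_throughE simp: image_iff)
  moreover have "inj_on (\<lambda>(X, p). insert l p) ?S"
    by (rule inj_on_subset[OF inj_on_insert_pencil_pair]) auto
  ultimately have "card {t \<in> triangles. l \<in> t \<and> Q t} = card ?S"
    by (simp add: card_image)
  also have "\<dots> = (\<Sum>X\<in>U - l. card {p. p \<subseteq> pencil l X \<and> card p = 2 \<and> Q (insert l p)})"
    using finite_points finite_pencil by (intro card_SigmaI) auto
  finally show ?thesis .
qed

lemma sum_card_triangles_through:
  "(\<Sum>l\<in>L. card {t \<in> triangles. l \<in> t \<and> Q l t}) = (\<Sum>t\<in>triangles. card {l \<in> t. Q l t})"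
proof (rule sum_multicount_gen[OF finite_blocks finite_triangles], rule ballI)
  fix t assume "t \<in> triangles"
  then have "{l \<in> L. l \<in> t \<and> Q l t} = {l \<in> t. Q l t}" by (auto simp: triangles_def)
  then show "card {l \<in> L. l \<in> t \<and> Q l t} = card {l \<in> t. Q l t}" by simp
qed

lemma card_triangles: "6 * card triangles = card L * (card U - k) * (k * (k - 1))"
proof -
  have "3 * card triangles = (\<Sum>t\<in>triangles. card {l \<in> t. True})"
    by (simp add: triangles_def)
  also have "\<dots> = (\<Sum>l\<in>L. card {t \<in> triangles. l \<in> t \<and> True})"
    by (rule sum_card_triangles_through[symmetric])
  also have "\<dots> = (\<Sum>l\<in>L. (card U - k) * (k choose 2))"
    by (intro sum.cong refl, subst card_triangles_through)
      (simp_all add: n_subsets finite_pencil card_pencil card_points_off_block)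
  finally have "6 * card triangles = card L * (card U - k) * (2 * (k choose 2))"
    by simp
  also have "2 * (k choose 2) = k * (k - 1)"
    using times_binomial_minus1_eq[of 2 k] by simp
  finally show ?thesis .
qed

lemma card_bichromatic_at_le:
  assumes "l \<in> L"
  shows "4 * card {t \<in> triangles. l \<in> t \<and> bichromatic_at col l t} \<le> (card U - k) * k\<^sup>2"
proof -
  have "4 * card {t \<in> triangles. l \<in> t \<and> bichromatic_at col l t} =
      (\<Sum>X\<in>U - l. 4 * card {p. p \<subseteq> pencil l X \<and> card p = 2 \<and> bichromatic_at col l (insert l p)})"
    by (simp add: card_triangles_through[OF assms] sum_distrib_left)
  also have "\<dots> \<le> (\<Sum>X\<in>U - l. k\<^sup>2)"
  proof (rule sum_mono)
    fix X assume X: "X \<in> U - l"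
    have "bichromatic_at col l (insert l p) \<longleftrightarrow> (\<exists>m\<in>p. \<exists>n\<in>p. col {l, m} \<noteq> col {l, n})"
      if "p \<subseteq> pencil l X" for p
    proof -
      have "insert l p - {l} = p"
        using that X by (auto simp: mem_pencil_iff)
      then show ?thesis by (simp add: bichromatic_at_def)
    qed
    then have "{p. p \<subseteq> pencil l X \<and> card p = 2 \<and> bichromatic_at col l (insert l p)} =
        {p. p \<subseteq> pencil l X \<and> card p = 2 \<and> (\<exists>m\<in>p. \<exists>n\<in>p. col {l, m} \<noteq> col {l, n})}"
      by blast
    then show "4 * card {p. p \<subseteq> pencil l X \<and> card p = 2 \<and> bichromatic_at col l (insert l p)} \<le> k\<^sup>2"
      using card_split_pairs_le[OF finite_pencil, of l X "\<lambda>m. col {l, m}"]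
      by (simp only: card_pencil[OF assms X])
  qed
  also have "\<dots> = (card U - k) * k\<^sup>2"
    by (simp add: card_points_off_block[OF assms])
  finally show ?thesis .
qed

theorem card_not_monochromatic_triangles_le:
  "4 * (k - 1) * card {t \<in> triangles. \<not> monochromatic col t} \<le> 3 * k * card triangles"
proof -
  let ?B = "{t \<in> triangles. \<not> monochromatic col t}"
  have "2 * card ?B = (\<Sum>t\<in>?B. 2)" by simp
  also have "\<dots> \<le> (\<Sum>t\<in>?B. card {l \<in> t. bichromatic_at col l t})"
    by (rule sum_mono) (auto simp: triangles_def intro: two_le_card_bichromatic_at)
  also have "\<dots> \<le> (\<Sum>t\<in>triangles. card {l \<in> t. bichromatic_at col l t})"
    by (rule sum_mono2) (use finite_triangles in auto)
  also have "\<dots> = (\<Sum>l\<in>L. card {t \<in> triangles. l \<in> t \<and> bichromatic_at col l t})"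
    by (rule sum_card_triangles_through[symmetric])
  finally have "8 * card ?B \<le> (\<Sum>l\<in>L. 4 * card {t \<in> triangles. l \<in> t \<and> bichromatic_at col l t})"
    by (simp flip: sum_distrib_left)
  also have "\<dots> \<le> (\<Sum>l\<in>L. (card U - k) * k\<^sup>2)"
    by (rule sum_mono) (rule card_bichromatic_at_le)
  finally have "8 * card ?B * (k - 1) \<le> card L * ((card U - k) * k\<^sup>2) * (k - 1)"
    by (intro mult_le_mono1) simp
  also have "\<dots> = k * (6 * card triangles)"
    unfolding card_triangles by (simp add: power2_eq_square ac_simps)
  finally show ?thesis by simp
qed

end

section \<open>Power maps in finite fields\<close>

lemma (in comm_group) card_pow_fibre_le:
  fixes e :: nat
  assumes "finite (carrier G)"
  shows "card {x \<in> carrier G. x [^] e = y} \<le> card {x \<in> carrier G. x [^] e = \<one>}"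
proof (cases "{x \<in> carrier G. x [^] e = y} = {}")
  case False
  then obtain z where z: "z \<in> carrier G" "z [^] e = y" by blast
  then have "z [^] e \<otimes> inv z [^] e = \<one>"
    by (subst pow_mult_distrib[symmetric]) (auto simp: m_comm)
  then have "(\<lambda>x. x \<otimes> inv z) ` {x \<in> carrier G. x [^] e = y} \<subseteq> {x \<in> carrier G. x [^] e = \<one>}"
    using z by (auto simp: pow_mult_distrib m_comm)
  moreover have "inj_on (\<lambda>x. x \<otimes> inv z) {x \<in> carrier G. x [^] e = y}"
    by (rule inj_on_subset[OF inj_on_multc[of "inv z"]]) (use z in auto)
  ultimately show ?thesis
    using assms by (intro card_inj_on_le) auto
next
  case True
  then show ?thesis by (simp only: card.empty)
qed

text \<open>Each fibre of \<open>x \<mapsto> x\<^sup>e\<close> has at most \<open>e\<close> elements and the image lies in the set of \<open>d\<close>-th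
  roots of unity; since the group has \<open>d * e\<close> elements, equality holds everywhere.\<close>

lemma (in comm_group) card_pow_fibre:
  fixes d e :: nat
  assumes order: "order G = d * e" "d * e > 0"
    and roots: "card {x \<in> carrier G. x [^] d = \<one>} \<le> d" "card {x \<in> carrier G. x [^] e = \<one>} \<le> e"
    and y: "y \<in> carrier G" "y [^] d = \<one>"
  shows "card {x \<in> carrier G. x [^] e = y} = e"
proof -
  let ?D = "{y \<in> carrier G. y [^] d = \<one>}" and ?F = "\<lambda>y. {x \<in> carrier G. x [^] e = y}"
  have fin: "finite (carrier G)"
    using order by (auto simp: order_def intro: card_ge_0_finite)
  have le: "card (?F y) \<le> e" for y
    using card_pow_fibre_le[OF fin] roots(2) by (rule le_trans)
  have "carrier G = (\<Union>y\<in>?D. ?F y)"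
    using pow_order_eq_1 order by (auto simp: nat_pow_pow mult.commute)
  then have "d * e = card (\<Union>y\<in>?D. ?F y)"
    using order(1) by (simp add: order_def)
  also have "\<dots> = (\<Sum>y\<in>?D. card (?F y))"
    using fin by (intro card_UN_disjoint) auto
  finally have total: "(\<Sum>y\<in>?D. card (?F y)) = d * e" by simp
  have "(\<Sum>y\<in>?D. e) \<le> d * e"
    using roots(1) by simp
  moreover have "(\<Sum>y\<in>?D. card (?F y)) \<le> (\<Sum>y\<in>?D. e)"
    by (rule sum_mono) (rule le)
  ultimately have "(\<Sum>y\<in>?D. card (?F y)) = (\<Sum>y\<in>?D. e)"
    using total by (simp only: antisym)
  then show ?thesis
    by (rule sum_mono_inv) (use y fin le in auto)
qed

lemma (in field) comm_group_mult_of: "comm_group (mult_of R)"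
  unfolding mult_of_is_Units by (rule units_comm_group)

lemma (in field) card_nth_roots:
  fixes d e :: nat
  assumes fin: "finite (carrier R)" and de: "card (carrier R) - 1 = d * e"
    and y: "y \<in> carrier R" "y \<noteq> \<zero>" "y [^] d = \<one>"
  shows "card {x \<in> carrier R. x [^] e = y} = e"
proof -
  interpret G: comm_group "mult_of R" by (rule comm_group_mult_of)
  have "card {\<zero>, \<one>} \<le> card (carrier R)"
    using fin by (intro card_mono) auto
  then have pos: "d * e > 0" "d > 0" "e > 0" using de by (auto intro: gr0I)
  have roots: "card {x \<in> carrier (mult_of R). x [^] n = \<one>} \<le> n" if "n > 0" for n :: nat
  proof -
    have "card {x \<in> carrier (mult_of R). x [^] n = \<one>} \<le> card {x \<in> carrier R. x [^] n = \<one>}"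
      using fin by (intro card_mono) auto
    also have "\<dots> \<le> n"
      using num_roots_le_deg[OF fin, of n] that by simp
    finally show ?thesis .
  qed
  have "order (mult_of R) = d * e"
    using fin de by (simp add: order_mult_of order_def)
  then have "card {x \<in> carrier (mult_of R). x [^] e = y} = e"
    using G.card_pow_fibre[of d e y] roots pos y by (simp add: nat_pow_mult_of)
  moreover have "{x \<in> carrier (mult_of R). x [^] e = y} = {x \<in> carrier R. x [^] e = y}"
    using y pos by (auto simp: nat_pow_zero)
  ultimately show ?thesis by simp
qed

lemma (in abelian_group) add_eq_zero_iff:
  "x \<in> carrier G \<Longrightarrow> y \<in> carrier G \<Longrightarrow> x \<oplus> y = \<zero> \<longleftrightarrow> y = \<ominus> x"
  using minus_equality[of y x] by (auto simp: a_comm r_neg)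

lemma (in cring) binomial_theorem:
  assumes [simp]: "x \<in> carrier R" "y \<in> carrier R"
  shows "(x \<oplus> y) [^] n = (\<Oplus>k\<in>{..n}. [(n choose k)] \<cdot> (x [^] k \<otimes> y [^] (n - k)))"
proof (induction n)
  case 0
  then show ?case by (simp add: add.nat_pow_eone)
next
  case (Suc n)
  let ?t = "\<lambda>k. x [^] k \<otimes> y [^] (n - k)" and ?s = "\<lambda>k. x [^] Suc k \<otimes> y [^] (n - k)"
  let ?sum = "\<Oplus>k\<in>{..n}. [(n choose k)] \<cdot> ?t k"
  have times_x: "?sum \<otimes> x = (\<Oplus>k\<in>{..n}. [(n choose k)] \<cdot> ?s k)"
    by (subst finsum_ldistr) (auto intro!: finsum_cong' simp: add_pow_rdistr m_ac)
  have "?sum \<otimes> y = (\<Oplus>k\<in>{..n}. [(n choose k)] \<cdot> (x [^] k \<otimes> y [^] (Suc n - k)))"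
    by (subst finsum_ldistr) (auto intro!: finsum_cong' simp: add_pow_ldistr m_assoc Suc_diff_le)
  also have "\<dots> = (\<Oplus>k\<in>{..Suc n}. [(n choose k)] \<cdot> (x [^] k \<otimes> y [^] (Suc n - k)))"
    by (subst finsum_Suc) (auto intro!: finsum_closed simp: binomial_eq_0)
  also have "\<dots> = (\<Oplus>k\<in>{..n}. [(n choose Suc k)] \<cdot> ?s k) \<oplus> y [^] Suc n"
    by (subst finsum_Suc2) auto
  finally have times_y: "?sum \<otimes> y = (\<Oplus>k\<in>{..n}. [(n choose Suc k)] \<cdot> ?s k) \<oplus> y [^] Suc n" .
  have "(x \<oplus> y) [^] Suc n = ?sum \<otimes> x \<oplus> ?sum \<otimes> y"
    by (simp add: Suc r_distr)
  also have "\<dots> = ((\<Oplus>k\<in>{..n}. [(n choose k)] \<cdot> ?s k) \<oplus> (\<Oplus>k\<in>{..n}. [(n choose Suc k)] \<cdot> ?s k)) \<oplus> y [^] Suc n"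
    unfolding times_x times_y by (intro a_assoc[symmetric]) (auto intro!: finsum_closed)
  also have "(\<Oplus>k\<in>{..n}. [(n choose k)] \<cdot> ?s k) \<oplus> (\<Oplus>k\<in>{..n}. [(n choose Suc k)] \<cdot> ?s k) =
      (\<Oplus>k\<in>{..n}. [(n choose k)] \<cdot> ?s k \<oplus> [(n choose Suc k)] \<cdot> ?s k)"
    by (intro finsum_addf[symmetric]) auto
  also have "\<dots> = (\<Oplus>k\<in>{..n}. [(Suc n choose Suc k)] \<cdot> ?s k)"
    by (intro finsum_cong') (auto simp: add.nat_pow_mult)
  also have "\<dots> \<oplus> y [^] Suc n = (\<Oplus>k\<in>{..Suc n}. [(Suc n choose k)] \<cdot> (x [^] k \<otimes> y [^] (Suc n - k)))"
    by (subst finsum_Suc2) auto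
  finally show ?case .
qed

lemma (in cring) add_pow_eq_zero_if_dvd:
  assumes "[(p :: nat)] \<cdot> \<one> = \<zero>" "p dvd n" "x \<in> carrier R"
  shows "[n] \<cdot> x = \<zero>"
proof -
  have "[p] \<cdot> x = \<zero>"
    using add_pow_ldistr[of \<one> x p] assms by simp
  then show ?thesis
    using assms(2,3) by (auto simp: dvd_def add.nat_pow_pow[symmetric])
qed

lemma (in cring) freshmans_dream:
  fixes p :: nat
  assumes p: "prime p" and char: "[p] \<cdot> \<one> = \<zero>" and [simp]: "x \<in> carrier R" "y \<in> carrier R"
  shows "(x \<oplus> y) [^] p = x [^] p \<oplus> y [^] p"
proof -
  obtain m where m: "p = Suc (Suc m)"
    using prime_ge_2_nat[OF p] by (metis add_2_eq_Suc le_Suc_ex)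
  let ?f = "\<lambda>k. [(p choose k)] \<cdot> (x [^] k \<otimes> y [^] (p - k))"
  have "(x \<oplus> y) [^] p = (\<Oplus>k\<in>{..Suc (Suc m)}. ?f k)"
    using binomial_theorem[of x y p] m by simp
  also have "\<dots> = ?f p \<oplus> (\<Oplus>k\<in>{..Suc m}. ?f k)"
    by (subst finsum_Suc) (auto simp: m)
  also have "(\<Oplus>k\<in>{..Suc m}. ?f k) = (\<Oplus>k\<in>{..m}. ?f (Suc k)) \<oplus> ?f 0"
    by (subst finsum_Suc2) auto
  also have "(\<Oplus>k\<in>{..m}. ?f (Suc k)) = (\<Oplus>k\<in>{..m}. \<zero>)"
  proof (intro finsum_cong')
    fix k assume "k \<in> {..m}"
    then have "p dvd (p choose Suc k)"
      using p m by (intro dvd_choose_prime) auto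
    then show "?f (Suc k) = \<zero>"
      by (intro add_pow_eq_zero_if_dvd[OF char]) auto
  qed auto
  finally show ?thesis by (simp add: add.nat_pow_eone)
qed

lemma (in cring) freshmans_dream_prime_power:
  fixes p :: nat
  assumes "prime p" "[p] \<cdot> \<one> = \<zero>" "x \<in> carrier R" "y \<in> carrier R"
  shows "(x \<oplus> y) [^] (p ^ k) = x [^] (p ^ k) \<oplus> y [^] (p ^ k)"
proof (induction k)
  case (Suc k)
  have "(x \<oplus> y) [^] (p ^ Suc k) = ((x \<oplus> y) [^] (p ^ k)) [^] p"
    using assms by (simp add: nat_pow_pow mult.commute)
  also have "\<dots> = (x [^] (p ^ k)) [^] p \<oplus> (y [^] (p ^ k)) [^] p"
    using assms Suc by (simp add: freshmans_dream)
  finally show ?case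
    using assms by (simp add: nat_pow_pow mult.commute)
qed (use assms in auto)

lemma (in domain) nat_pow_eq_zero_iff:
  assumes "x \<in> carrier R"
  shows "x [^] (n::nat) = \<zero> \<longleftrightarrow> x = \<zero> \<and> n > 0"
  using assms by (induction n) (auto simp: integral_iff)

lemma (in domain) add_pow_one_eq_zero_if_card_power:
  assumes "card (carrier R) = p ^ n"
  shows "[p] \<cdot> \<one> = \<zero>"
proof -
  have "[(p ^ k)] \<cdot> \<one> = ([p] \<cdot> \<one>) [^] k" for k
  proof (induction k)
    case (Suc k)
    have "[(p ^ Suc k)] \<cdot> \<one> = [p] \<cdot> ([(p ^ k)] \<cdot> \<one>)"
      by (simp add: add.nat_pow_pow mult.commute)
    also have "\<dots> = ([(p ^ k)] \<cdot> \<one>) \<otimes> ([p] \<cdot> \<one>)"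
      using add_pow_rdistr[of "[(p ^ k)] \<cdot> \<one>" \<one> p] by simp
    finally show ?case using Suc by simp
  qed simp
  moreover have "[(p ^ n)] \<cdot> \<one> = \<zero>"
    using add.pow_order_eq_1[of \<one>] assms by (simp add: order_def)
  ultimately show ?thesis
    using nat_pow_eq_zero_iff[of "[p] \<cdot> \<one>" n] by simp
qed

section \<open>The projective plane over a field\<close>

context ring
begin

definition vecs :: "('a \<times> 'a \<times> 'a) set" where
  "vecs = carrier R \<times> carrier R \<times> carrier R"

abbreviation vzero :: "'a \<times> 'a \<times> 'a" where
  "vzero \<equiv> (\<zero>, \<zero>, \<zero>)"

fun vscale :: "'a \<Rightarrow> 'a \<times> 'a \<times> 'a \<Rightarrow> 'a \<times> 'a \<times> 'a" where
  "vscale c (x, y, z) = (c \<otimes> x, c \<otimes> y, c \<otimes> z)"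

fun vadd :: "'a \<times> 'a \<times> 'a \<Rightarrow> 'a \<times> 'a \<times> 'a \<Rightarrow> 'a \<times> 'a \<times> 'a" where
  "vadd (a, b, c) (x, y, z) = (a \<oplus> x, b \<oplus> y, c \<oplus> z)"

abbreviation affine_point :: "'a \<times> 'a \<times> 'a \<Rightarrow> 'a \<times> 'a \<times> 'a \<Rightarrow> 'a \<Rightarrow> 'a \<times> 'a \<times> 'a" where
  "affine_point u v t \<equiv> vadd u (vscale t v)"

fun vdot :: "'a \<times> 'a \<times> 'a \<Rightarrow> 'a \<times> 'a \<times> 'a \<Rightarrow> 'a" where
  "vdot (a, b, c) (x, y, z) = a \<otimes> x \<oplus> b \<otimes> y \<oplus> c \<otimes> z"

fun vcross :: "'a \<times> 'a \<times> 'a \<Rightarrow> 'a \<times> 'a \<times> 'a \<Rightarrow> 'a \<times> 'a \<times> 'a" where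
  "vcross (a, b, c) (x, y, z) =
     (b \<otimes> z \<ominus> c \<otimes> y, c \<otimes> x \<ominus> a \<otimes> z, a \<otimes> y \<ominus> b \<otimes> x)"

lemma vecs_iff [simp]: "(x, y, z) \<in> vecs \<longleftrightarrow> x \<in> carrier R \<and> y \<in> carrier R \<and> z \<in> carrier R"
  by (simp add: vecs_def)

lemma nzvecs_eq: "nzvecs R = vecs - {vzero}"
  by (auto simp: nzvecs_def vecs_def)

lemma nzvecs_vecs: "u \<in> nzvecs R \<Longrightarrow> u \<in> vecs"
  by (simp add: nzvecs_eq)

lemma vec_closed [simp]:
  "u \<in> vecs \<Longrightarrow> c \<in> carrier R \<Longrightarrow> vscale c u \<in> vecs"
  "u \<in> vecs \<Longrightarrow> v \<in> vecs \<Longrightarrow> vadd u v \<in> vecs"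
  "u \<in> vecs \<Longrightarrow> v \<in> vecs \<Longrightarrow> vdot u v \<in> carrier R"
  "u \<in> vecs \<Longrightarrow> v \<in> vecs \<Longrightarrow> vcross u v \<in> vecs"
  by (cases u; cases v; simp)+

lemma pspan_eq: "pspan R v = (\<lambda>c. vscale c v) ` (carrier R - {\<zero>})"
  by (cases v) (auto simp: pspan_def)

end

context cring
begin

lemma vdot_commute:
  "u \<in> vecs \<Longrightarrow> v \<in> vecs \<Longrightarrow> vdot u v = vdot v u"
  by (cases u; cases v) (simp add: m_comm)

lemma vdot_linear [simp]:
  "u \<in> vecs \<Longrightarrow> v \<in> vecs \<Longrightarrow> w \<in> vecs \<Longrightarrow> vdot w (vadd u v) = vdot w u \<oplus> vdot w v"
  "u \<in> vecs \<Longrightarrow> v \<in> vecs \<Longrightarrow> w \<in> vecs \<Longrightarrow> vdot (vadd u v) w = vdot u w \<oplus> vdot v w"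
  "u \<in> vecs \<Longrightarrow> w \<in> vecs \<Longrightarrow> c \<in> carrier R \<Longrightarrow> vdot w (vscale c u) = c \<otimes> vdot w u"
  "u \<in> vecs \<Longrightarrow> w \<in> vecs \<Longrightarrow> c \<in> carrier R \<Longrightarrow> vdot (vscale c u) w = c \<otimes> vdot u w"
  "u \<in> vecs \<Longrightarrow> vdot vzero u = \<zero>" "u \<in> vecs \<Longrightarrow> vdot u vzero = \<zero>"
  by (cases u; cases v; cases w; simp; algebra)+

lemma vdot_vcross [simp]:
  assumes "u \<in> vecs" "v \<in> vecs"
  shows "vdot (vcross u v) u = \<zero>" "vdot (vcross u v) v = \<zero>"
  using assms by (cases u; cases v; simp; algebra)+

lemma vcross_zero_self [simp]:
  assumes "u \<in> vecs"
  shows "vcross u u = vzero" "vcross u vzero = vzero"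
  using assms by (cases u; simp add: m_comm a_minus_def r_neg)+

lemma vcross_linear:
  assumes "u \<in> vecs" "v \<in> vecs" "w \<in> vecs" "c \<in> carrier R"
  shows "vcross (vadd u v) w = vadd (vcross u w) (vcross v w)"
    "vcross w (vadd u v) = vadd (vcross w u) (vcross w v)"
    "vcross (vscale c u) w = vscale c (vcross u w)"
    "vcross w (vscale c u) = vscale c (vcross w u)"
  using assms by (cases u; cases v; cases w; simp; algebra)+

lemma vcross_vcross:
  assumes "u \<in> vecs" "v \<in> vecs" "w \<in> vecs"
  shows "vcross w (vcross u v) = vadd (vscale (vdot w v) u) (vscale (\<ominus> vdot w u) v)"
    "vcross (vcross u v) w = vadd (vscale (\<ominus> vdot w v) u) (vscale (vdot w u) v)"
  using assms by (cases u; cases v; cases w; simp; algebra)+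

lemma vector_space_simps [simp]:
  "u \<in> vecs \<Longrightarrow> c \<in> carrier R \<Longrightarrow> d \<in> carrier R \<Longrightarrow> vscale c (vscale d u) = vscale (c \<otimes> d) u"
  "u \<in> vecs \<Longrightarrow> vscale \<one> u = u"
  "u \<in> vecs \<Longrightarrow> vscale \<zero> u = vzero"
  "c \<in> carrier R \<Longrightarrow> vscale c vzero = vzero"
  "u \<in> vecs \<Longrightarrow> vadd vzero u = u"
  "u \<in> vecs \<Longrightarrow> vadd u vzero = u"
  "u \<in> vecs \<Longrightarrow> v \<in> vecs \<Longrightarrow> c \<in> carrier R \<Longrightarrow> vscale c (vadd u v) = vadd (vscale c u) (vscale c v)"
  by (cases u; cases v; simp; algebra)+

end

context field
begin

lemma nonzero_inv [simp]:
  assumes "c \<in> carrier R" "c \<noteq> \<zero>"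
  shows "inv c \<in> carrier R" "inv c \<noteq> \<zero>" "inv c \<otimes> c = \<one>" "c \<otimes> inv c = \<one>"
proof -
  have c: "c \<in> Units R" using assms field_Units by simp
  then show "inv c \<in> carrier R" "inv c \<otimes> c = \<one>" "c \<otimes> inv c = \<one>" by simp_all
  then show "inv c \<noteq> \<zero>" using assms(1) by auto
qed

lemma vscale_eq_vzero_iff:
  assumes "u \<in> vecs" "c \<in> carrier R"
  shows "vscale c u = vzero \<longleftrightarrow> c = \<zero> \<or> u = vzero"
  using assms by (cases u) (auto simp: integral_iff)

lemma vscale_nzvecs: "u \<in> nzvecs R \<Longrightarrow> c \<in> carrier R \<Longrightarrow> c \<noteq> \<zero> \<Longrightarrow> vscale c u \<in> nzvecs R"
  by (simp add: nzvecs_eq vscale_eq_vzero_iff)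

lemma vscale_right_cancel:
  assumes "u \<in> nzvecs R" "c \<in> carrier R" "d \<in> carrier R" "vscale c u = vscale d u"
  shows "c = d"
  using assms by (cases u) (auto simp: nzvecs_eq m_rcancel)

lemma vdot_eq_one_exists:
  assumes "u \<in> nzvecs R"
  obtains w where "w \<in> vecs" "vdot w u = \<one>"
proof -
  obtain x y z where u: "u = (x, y, z)" by (rule prod_cases3)
  have car: "x \<in> carrier R" "y \<in> carrier R" "z \<in> carrier R"
    using assms u by (auto simp: nzvecs_eq)
  consider (fst) "x \<noteq> \<zero>" | (snd) "y \<noteq> \<zero>" | (thd) "z \<noteq> \<zero>" using assms u by (auto simp: nzvecs_eq)
  then show ?thesis
  proof cases
    case fst then show ?thesis using that[of "(inv x, \<zero>, \<zero>)"] u car by simp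
  next
    case snd then show ?thesis using that[of "(\<zero>, inv y, \<zero>)"] u car by simp
  next
    case thd then show ?thesis using that[of "(\<zero>, \<zero>, inv z)"] u car by simp
  qed
qed

lemma vadd_eq_vzeroD:
  assumes "u \<in> vecs" "v \<in> vecs" "vadd u v = vzero"
  shows "u = vscale (\<ominus> \<one>) v"
  using assms by (cases u; cases v) (auto simp: l_minus minus_equality)

lemma vcross_eq_vzeroD:
  assumes "u \<in> vecs" "v \<in> nzvecs R" "vcross u v = vzero"
  obtains c where "c \<in> carrier R" "u = vscale c v"
proof -
  have v: "v \<in> vecs" using assms(2) by (rule nzvecs_vecs)
  obtain w where w: "w \<in> vecs" "vdot w v = \<one>"
    using vdot_eq_one_exists[OF assms(2)] .
  then have "vzero = vadd u (vscale (\<ominus> vdot w u) v)"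
    using vcross_vcross(1)[OF assms(1) v w(1)] assms by simp
  then have "u = vscale (vdot w u) v"
    using vadd_eq_vzeroD[of u "vscale (\<ominus> vdot w u) v"] assms(1) v w(1) by (simp add: l_minus)
  then show ?thesis
    using that[of "vdot w u"] assms(1) w(1) by simp
qed

lemma pspan_vscale:
  assumes "u \<in> vecs" "c \<in> carrier R" "c \<noteq> \<zero>"
  shows "pspan R (vscale c u) = pspan R u"
proof -
  have "(\<lambda>d. d \<otimes> c) ` (carrier R - {\<zero>}) = carrier R - {\<zero>}"
  proof (intro equalityI subsetI)
    fix d assume d: "d \<in> carrier R - {\<zero>}"
    then have "d = (d \<otimes> inv c) \<otimes> c"
      using assms(2,3) by (simp add: m_assoc)
    then show "d \<in> (\<lambda>d. d \<otimes> c) ` (carrier R - {\<zero>})"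
      using d assms(2,3) by (intro image_eqI[of _ _ "d \<otimes> inv c"]) (auto simp: integral_iff)
  qed (use assms in \<open>auto simp: integral_iff\<close>)
  then have "pspan R u = (\<lambda>d. vscale d u) ` (\<lambda>d. d \<otimes> c) ` (carrier R - {\<zero>})"
    by (simp only: pspan_eq)
  also have "\<dots> = pspan R (vscale c u)"
    unfolding pspan_eq image_image using assms by (intro image_cong) auto
  finally show ?thesis ..
qed

lemma mem_pspan_self: "u \<in> vecs \<Longrightarrow> u \<in> pspan R u"
  unfolding pspan_eq by (intro image_eqI[of _ _ \<one>]) auto

lemma mem_pspanE:
  assumes "x \<in> pspan R u"
  obtains c where "c \<in> carrier R" "c \<noteq> \<zero>" "x = vscale c u"
  using assms by (auto simp: pspan_eq)

lemma pspan_eq_if_mem: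
  assumes "u \<in> vecs" "x \<in> pspan R u"
  shows "pspan R x = pspan R u"
  using assms pspan_vscale by (metis mem_pspanE)

lemma pspan_eqD:
  assumes "u \<in> vecs" "pspan R u = pspan R v"
  obtains c where "c \<in> carrier R" "c \<noteq> \<zero>" "u = vscale c v"
  using mem_pspan_self[OF assms(1)] assms(2) by (auto elim: mem_pspanE)

lemma pspan_eqI:
  assumes "u \<in> nzvecs R" "v \<in> vecs" "c \<in> carrier R" "u = vscale c v"
  shows "pspan R u = pspan R v"
proof -
  have "c \<noteq> \<zero>" using assms by (auto simp: nzvecs_eq)
  then show ?thesis using assms pspan_vscale by simp
qed

lemma card_pspan_image:
  assumes fin: "finite (carrier R)" and S: "S \<subseteq> nzvecs R"
    and scale: "\<And>u c. u \<in> S \<Longrightarrow> c \<in> carrier R \<Longrightarrow> c \<noteq> \<zero> \<Longrightarrow> vscale c u \<in> S"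
  shows "(card (carrier R) - 1) * card (pspan R ` S) = card S"
proof -
  have vecs: "u \<in> vecs" if "u \<in> S" for u
    using that S by (auto simp: nzvecs_eq)
  have "finite S"
    by (rule finite_subset[of _ vecs]) (use fin vecs in \<open>auto simp: vecs_def\<close>)
  have union: "\<Union>(pspan R ` S) = S"
    using vecs mem_pspan_self scale by (auto elim!: mem_pspanE)
  have "(card (carrier R) - 1) * card (pspan R ` S) = card (\<Union>(pspan R ` S))"
  proof (rule card_partition)
    fix P assume "P \<in> pspan R ` S"
    then obtain u where u: "u \<in> S" "P = pspan R u" by blast
    have "inj_on (\<lambda>c. vscale c u) (carrier R - {\<zero>})"
      using vscale_right_cancel S u(1) by (intro inj_onI) blast
    then show "card P = card (carrier R) - 1"
      using fin u(2) by (simp add: pspan_eq card_image)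
  next
    fix P Q assume "P \<in> pspan R ` S" "Q \<in> pspan R ` S" "P \<noteq> Q"
    then show "P \<inter> Q = {}"
      using vecs pspan_eq_if_mem by blast
  qed (use \<open>finite S\<close> union in simp_all)
  then show ?thesis by (simp only: union)
qed

lemma mem_pline_iff:
  assumes "l \<in> vecs" "u \<in> nzvecs R"
  shows "pspan R u \<in> pline R l \<longleftrightarrow> vdot l u = \<zero>"
proof
  assume "vdot l u = \<zero>"
  with assms show "pspan R u \<in> pline R l"
    by (cases u; cases l) (auto simp: pline_def)
next
  assume "pspan R u \<in> pline R l"
  then obtain v where v: "v \<in> nzvecs R" "vdot l v = \<zero>" "pspan R u = pspan R v"
    by (cases l) (auto simp: pline_def)
  then obtain c where "c \<in> carrier R" "u = vscale c v"
    using pspan_eqD[of u v] assms by (auto simp: nzvecs_eq)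
  then show "vdot l u = \<zero>"
    using v assms by (simp add: nzvecs_eq)
qed

lemma mem_plineE:
  assumes "P \<in> pline R l"
  obtains u where "u \<in> nzvecs R" "P = pspan R u" "vdot l u = \<zero>"
  using assms by (cases l) (auto simp: pline_def)

lemma vcross_nzvecs:
  assumes "u \<in> nzvecs R" "v \<in> nzvecs R" "pspan R u \<noteq> pspan R v"
  shows "vcross u v \<in> nzvecs R"
proof (rule ccontr)
  assume "vcross u v \<notin> nzvecs R"
  then have "vcross u v = vzero"
    using assms(1,2) by (simp add: nzvecs_eq)
  then obtain c where "c \<in> carrier R" "u = vscale c v"
    using vcross_eq_vzeroD[OF nzvecs_vecs[OF assms(1)] assms(2)] by blast
  then show False
    using pspan_eqI[OF assms(1) nzvecs_vecs[OF assms(2)]] assms(3) by blast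
qed

lemma lincomb_eqD:
  assumes uv: "u \<in> nzvecs R" "v \<in> nzvecs R" "pspan R u \<noteq> pspan R v"
    and car: "a \<in> carrier R" "b \<in> carrier R" "c \<in> carrier R" "d \<in> carrier R"
    and eq: "vadd (vscale a u) (vscale b v) = vadd (vscale c u) (vscale d v)"
  shows "a = c" "b = d"
proof -
  note vecs = uv(1,2)[THEN nzvecs_vecs]
  have "vcross (vadd (vscale x u) (vscale y v)) v = vscale x (vcross u v)"
    "vcross u (vadd (vscale x u) (vscale y v)) = vscale y (vcross u v)"
    if "x \<in> carrier R" "y \<in> carrier R" for x y
    using that vecs by (simp_all add: vcross_linear)
  then have "vscale a (vcross u v) = vscale c (vcross u v)" "vscale b (vcross u v) = vscale d (vcross u v)"
    using car eq by metis+
  then show "a = c" "b = d"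
    using vscale_right_cancel[OF vcross_nzvecs[OF uv]] car by blast+
qed

lemma affine_point_nzvecs:
  assumes "u \<in> nzvecs R" "v \<in> nzvecs R" "pspan R u \<noteq> pspan R v" "t \<in> carrier R"
  shows "affine_point u v t \<in> nzvecs R"
  using lincomb_eqD(1)[OF assms(1-3), of \<one> t \<zero> \<zero>] assms(4) assms(1,2)[THEN nzvecs_vecs]
  by (auto simp: nzvecs_eq)

lemma inj_on_affine_points:
  assumes uv: "u \<in> nzvecs R" "v \<in> nzvecs R" "pspan R u \<noteq> pspan R v"
  shows "inj_on (\<lambda>t. pspan R (affine_point u v t)) (carrier R)"
proof (rule inj_onI)
  note vecs = uv(1,2)[THEN nzvecs_vecs]
  fix s t assume st: "s \<in> carrier R" "t \<in> carrier R"
    and eq: "pspan R (affine_point u v s) = pspan R (affine_point u v t)"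
  obtain k where k: "k \<in> carrier R" "affine_point u v s = vscale k (affine_point u v t)"
    using pspan_eqD[OF _ eq] st vecs by auto
  then have "vadd (vscale \<one> u) (vscale s v) = vadd (vscale k u) (vscale (k \<otimes> t) v)"
    using st vecs by simp
  then have "\<one> = k" "s = k \<otimes> t"
    using lincomb_eqD[OF uv, of \<one> s k "k \<otimes> t"] k(1) st by simp_all
  then show "s = t" using st by (metis l_one)
qed

lemma pspan_neq_affine_point:
  assumes uv: "u \<in> nzvecs R" "v \<in> nzvecs R" "pspan R u \<noteq> pspan R v" and t: "t \<in> carrier R"
  shows "pspan R v \<noteq> pspan R (affine_point u v t)"
proof
  note vecs = uv(1,2)[THEN nzvecs_vecs]
  assume "pspan R v = pspan R (affine_point u v t)"
  then obtain k where k: "k \<in> carrier R" "k \<noteq> \<zero>" "v = vscale k (affine_point u v t)"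
    using pspan_eqD[OF vecs(2)] by blast
  then have "vadd (vscale \<zero> u) (vscale \<one> v) = vadd (vscale k u) (vscale (k \<otimes> t) v)"
    using t vecs by simp
  then show False
    using lincomb_eqD(1)[OF uv, of \<zero> \<one> k "k \<otimes> t"] k t by simp
qed

lemma pspan_eq_vcross:
  assumes "u \<in> nzvecs R" "v \<in> nzvecs R" "pspan R u \<noteq> pspan R v"
    and "l \<in> nzvecs R" "vdot l u = \<zero>" "vdot l v = \<zero>"
  shows "pspan R l = pspan R (vcross u v)"
proof -
  note vecs = assms(1,2,4)[THEN nzvecs_vecs]
  have "vcross l (vcross u v) = vzero"
    using vecs assms(5,6) by (simp add: vcross_vcross)
  then obtain c where "c \<in> carrier R" "l = vscale c (vcross u v)"
    using vcross_eq_vzeroD[OF vecs(3) vcross_nzvecs[OF assms(1-3)]] by blast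
  then show ?thesis
    using pspan_eqI[OF assms(4)] vecs by simp
qed

lemma pline_cong:
  assumes "l \<in> nzvecs R" "m \<in> nzvecs R" "pspan R l = pspan R m"
  shows "pline R l = pline R m"
proof -
  note vecs = assms(1,2)[THEN nzvecs_vecs]
  obtain c where c: "c \<in> carrier R" "c \<noteq> \<zero>" "l = vscale c m"
    using pspan_eqD[OF vecs(1) assms(3)] .
  have "vdot l u = \<zero> \<longleftrightarrow> vdot m u = \<zero>" if "u \<in> nzvecs R" for u
    using c vecs nzvecs_vecs[OF that] by (simp add: integral_iff)
  then show ?thesis
    using mem_pline_iff vecs by (metis mem_plineE subsetI equalityI)
qed

lemma plines_eq_pline_vcross:
  assumes "u \<in> nzvecs R" "v \<in> nzvecs R" "pspan R u \<noteq> pspan R v"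
    and "l \<in> plines R" "pspan R u \<in> l" "pspan R v \<in> l"
  shows "l = pline R (vcross u v)"
proof -
  obtain a where a: "a \<in> nzvecs R" "l = pline R a"
    using assms(4) by (auto simp: plines_def)
  then have "vdot a u = \<zero>" "vdot a v = \<zero>"
    using mem_pline_iff[OF nzvecs_vecs] assms by metis+
  then have "pspan R a = pspan R (vcross u v)"
    using pspan_eq_vcross[OF assms(1-3) a(1)] by blast
  then show ?thesis
    using pline_cong[OF a(1) vcross_nzvecs[OF assms(1-3)]] a(2) by simp
qed

lemma pline_vcross_mem:
  assumes "u \<in> nzvecs R" "v \<in> nzvecs R"
  shows "pspan R u \<in> pline R (vcross u v)" "pspan R v \<in> pline R (vcross u v)"
  using assms[THEN nzvecs_vecs] by (simp_all add: mem_pline_iff assms)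

lemma plines_eqI:
  assumes "l \<in> plines R" "m \<in> plines R" "P \<in> l \<inter> m" "Q \<in> l \<inter> m" "P \<noteq> Q"
  shows "l = m"
proof -
  obtain u v where "u \<in> nzvecs R" "P = pspan R u" "v \<in> nzvecs R" "Q = pspan R v"
    using assms unfolding plines_def by (blast elim: mem_plineE)
  then show ?thesis
    using plines_eq_pline_vcross assms by (metis IntD1 IntD2)
qed

lemma plines_meet:
  assumes "l \<in> plines R" "m \<in> plines R" "l \<noteq> m"
  obtains P where "l \<inter> m = {P}"
proof -
  obtain a b where ab: "a \<in> nzvecs R" "b \<in> nzvecs R" "l = pline R a" "m = pline R b"
    using assms unfolding plines_def by blast
  then have "pspan R a \<noteq> pspan R b"
    using assms(3) pline_cong by blast
  then have "vcross a b \<in> nzvecs R"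
    using vcross_nzvecs ab by blast
  then have "pspan R (vcross a b) \<in> l \<inter> m"
    using ab by (simp add: mem_pline_iff nzvecs_vecs vdot_commute[of _ "vcross a b"])
  then have "l \<inter> m = {pspan R (vcross a b)}"
    using plines_eqI[OF assms(1,2)] assms(3) by blast
  then show ?thesis by (rule that)
qed

lemma mem_span_if_perp_vcross:
  assumes uv: "u \<in> nzvecs R" "v \<in> nzvecs R" "pspan R u \<noteq> pspan R v"
    and x: "x \<in> vecs" "vdot (vcross u v) x = \<zero>"
  obtains a b where "a \<in> carrier R" "b \<in> carrier R" "x = vadd (vscale a u) (vscale b v)"
proof -
  note vecs = uv(1,2)[THEN nzvecs_vecs]
  let ?n = "vcross u v"
  obtain s where s: "s \<in> vecs" "vdot s ?n = \<one>"
    using vdot_eq_one_exists[OF vcross_nzvecs[OF uv]] .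
  define y where "y = vcross x s"
  have y: "y \<in> vecs" using x(1) s(1) by (simp add: y_def)
  have "vdot ?n s = \<one>" using s vecs by (simp add: vdot_commute)
  then have "x = vcross ?n y"
    using vcross_vcross(1)[of x s ?n] x s(1) vecs by (simp add: y_def)
  also have "\<dots> = vadd (vscale (\<ominus> vdot y v) u) (vscale (vdot y u) v)"
    using vecs y by (rule vcross_vcross(2))
  finally show ?thesis
    using that[of "\<ominus> vdot y v" "vdot y u"] vecs y by simp
qed

lemma pline_vcross_eq:
  assumes uv: "u \<in> nzvecs R" "v \<in> nzvecs R" "pspan R u \<noteq> pspan R v"
  shows "pline R (vcross u v) = insert (pspan R v) ((\<lambda>t. pspan R (affine_point u v t)) ` carrier R)"
proof -
  note vecs = uv(1,2)[THEN nzvecs_vecs]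
  let ?point = "\<lambda>t. pspan R (affine_point u v t)"
  have "P \<in> insert (pspan R v) (?point ` carrier R)" if P: "P \<in> pline R (vcross u v)" for P
  proof -
    obtain x where x: "x \<in> nzvecs R" "P = pspan R x" "vdot (vcross u v) x = \<zero>"
      using mem_plineE[OF P] .
    then obtain a b where ab: "a \<in> carrier R" "b \<in> carrier R" "x = vadd (vscale a u) (vscale b v)"
      using mem_span_if_perp_vcross[OF uv] nzvecs_vecs by blast
    show ?thesis
    proof (cases "a = \<zero>")
      case True
      then have "x = vscale b v" using ab vecs by simp
      then show ?thesis using pspan_eqI[of x v b] x ab vecs by simp
    next
      case False
      then have "x = vscale a (affine_point u v (inv a \<otimes> b))"
        using ab vecs by (simp add: m_assoc[symmetric])
      from pspan_eqI[OF x(1) _ ab(1) this] have "P = ?point (inv a \<otimes> b)"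
        using x(2) ab(1,2) False vecs by simp
      then show ?thesis using ab False by simp
    qed
  qed
  moreover have "?point t \<in> pline R (vcross u v)" if "t \<in> carrier R" for t
    using mem_pline_iff affine_point_nzvecs[OF uv that] vecs that by simp
  ultimately show ?thesis
    using pline_vcross_mem(2)[OF uv(1,2)] by auto
qed

end

section \<open>The Hermitian unital\<close>

locale hermitian_plane = field R for R (structure) +
  fixes q :: nat
  assumes finite_carrier: "finite (carrier R)"
    and card_carrier: "card (carrier R) = q ^ 2"
    and prime_power: "is_prime_power q"
begin

lemma q_ge_2: "q \<ge> 2"
proof -
  obtain p k where "prime p" "k \<ge> 1" "q = p ^ k"
    using prime_power by (auto simp: is_prime_power_def)
  then show ?thesis
    using prime_ge_2_nat[of p] self_le_power[of p k] by auto
qed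

definition bar :: "'a \<Rightarrow> 'a" where
  "bar x = x [^] q"

lemma bar_ring_hom: "bar \<in> ring_hom R R"
proof (rule ring_hom_memI)
  obtain p k where pk: "prime p" "q = p ^ k"
    using prime_power by (auto simp: is_prime_power_def)
  then have "[p] \<cdot> \<one> = \<zero>"
    using add_pow_one_eq_zero_if_card_power[of p "k * 2"] card_carrier by (simp add: power_mult)
  then show "bar (x \<oplus> y) = bar x \<oplus> bar y" if "x \<in> carrier R" "y \<in> carrier R" for x y
    unfolding bar_def using freshmans_dream_prime_power[OF pk(1)] that pk(2) by simp
qed (simp_all add: bar_def nat_pow_distrib)

sublocale bar: ring_hom_cring R R bar
  by unfold_locales (rule bar_ring_hom)

lemma bar_bar [simp]:
  assumes "x \<in> carrier R"
  shows "bar (bar x) = x"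
proof (cases "x = \<zero>")
  case False
  interpret G: group "mult_of R" by (rule field_mult_group)
  have "x [^] (q ^ 2 - 1) = \<one>"
    using G.pow_order_eq_1[of x] False assms finite_carrier card_carrier
    by (simp add: order_def nat_pow_mult_of)
  then have "x [^] Suc (q ^ 2 - 1) = x" using assms by simp
  also have "Suc (q ^ 2 - 1) = q * q" using q_ge_2 by (simp add: power2_eq_square)
  finally show ?thesis using assms by (simp add: bar_def nat_pow_pow)
qed simp

lemma bar_eq_zero_iff [simp]: "x \<in> carrier R \<Longrightarrow> bar x = \<zero> \<longleftrightarrow> x = \<zero>"
  by (metis bar.hom_zero bar_bar)

definition field_norm :: "'a \<Rightarrow> 'a" where
  "field_norm x = x [^] (q + 1)"

lemma field_norm_eq: "x \<in> carrier R \<Longrightarrow> field_norm x = x \<otimes> bar x"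
  by (simp add: field_norm_def bar_def m_comm)

lemma field_norm_simps [simp]:
  assumes "x \<in> carrier R"
  shows "field_norm x \<in> carrier R" "bar (field_norm x) = field_norm x" "field_norm x = \<zero> \<longleftrightarrow> x = \<zero>"
  using assms by (auto simp: field_norm_eq m_comm integral_iff)

lemma bar_eq_pow: "x \<in> carrier R \<Longrightarrow> bar x = x [^] (q - 1) \<otimes> x"
  using q_ge_2 nat_pow_Suc[of x "q - 1"] by (simp add: bar_def)

lemma card_carrier_minus_1:
  "card (carrier R) - 1 = (q - 1) * (q + 1)" "card (carrier R) - 1 = (q + 1) * (q - 1)"
  by (simp_all add: card_carrier power2_eq_square algebra_simps)

lemma card_field_norm_fibre:
  assumes "b \<in> carrier R" "bar b = b"
  shows "card {z \<in> carrier R. field_norm z = b} = (if b = \<zero> then 1 else q + 1)"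
proof (cases "b = \<zero>")
  case True
  then have "{z \<in> carrier R. field_norm z = b} = {\<zero>}" by auto
  then show ?thesis using True by simp
next
  case False
  have "b [^] (q - 1) \<otimes> b = \<one> \<otimes> b" using assms bar_eq_pow[of b] by simp
  then have "b [^] (q - 1) = \<one>" using assms False m_rcancel[of b "b [^] (q - 1)" \<one>] by simp
  then show ?thesis
    unfolding field_norm_def
    using card_nth_roots[OF finite_carrier card_carrier_minus_1(1), of b] False assms by simp
qed

lemma trace_eq_zero_iff:
  assumes "s \<in> carrier R"
  shows "s \<oplus> bar s = \<zero> \<longleftrightarrow> s = \<zero> \<or> s [^] (q - 1) = \<ominus> \<one>"
proof -
  have "s \<oplus> bar s = (\<one> \<oplus> s [^] (q - 1)) \<otimes> s"
    using assms bar_eq_pow[of s] by (simp add: l_distr)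
  then have "s \<oplus> bar s = \<zero> \<longleftrightarrow> s = \<zero> \<or> \<one> \<oplus> s [^] (q - 1) = \<zero>"
    using assms by (auto simp: integral_iff)
  also have "\<one> \<oplus> s [^] (q - 1) = \<zero> \<longleftrightarrow> s [^] (q - 1) = \<ominus> \<one>"
    using assms add_eq_zero_iff by simp
  finally show ?thesis .
qed

lemma card_trace_zero: "card {s \<in> carrier R. s \<oplus> bar s = \<zero>} = q"
proof -
  have nonzero: "\<ominus> \<one> \<noteq> \<zero>" by (metis add.inv_eq_1_iff one_closed zero_not_one)
  have "(\<ominus> \<one>) [^] (q + 1) = \<one>"
    using field_norm_eq[of "\<ominus> \<one>"] by (simp add: field_norm_def l_minus)
  then have "card {s \<in> carrier R. s [^] (q - 1) = \<ominus> \<one>} = q - 1"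
    using card_nth_roots[OF finite_carrier card_carrier_minus_1(2), of "\<ominus> \<one>"] nonzero by simp
  moreover have "{s \<in> carrier R. s \<oplus> bar s = \<zero>} = insert \<zero> {s \<in> carrier R. s [^] (q - 1) = \<ominus> \<one>}"
    using trace_eq_zero_iff by auto
  moreover have "\<zero> [^] (q - 1) \<noteq> \<ominus> \<one>"
    using q_ge_2 nonzero[symmetric] by (simp add: nat_pow_zero)
  ultimately show ?thesis
    using finite_carrier q_ge_2 by simp
qed

fun vbar :: "'a \<times> 'a \<times> 'a \<Rightarrow> 'a \<times> 'a \<times> 'a" where
  "vbar (x, y, z) = (bar x, bar y, bar z)"

definition herm :: "'a \<times> 'a \<times> 'a \<Rightarrow> 'a \<times> 'a \<times> 'a \<Rightarrow> 'a" where
  "herm u v = vdot u (vbar v)"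

definition isotropic :: "'a \<times> 'a \<times> 'a \<Rightarrow> bool" where
  "isotropic u \<longleftrightarrow> u \<in> nzvecs R \<and> herm u u = \<zero>"

lemma vbar_simps [simp]:
  "u \<in> vecs \<Longrightarrow> vbar u \<in> vecs"
  "u \<in> vecs \<Longrightarrow> vbar (vbar u) = u"
  "u \<in> vecs \<Longrightarrow> v \<in> vecs \<Longrightarrow> vbar (vadd u v) = vadd (vbar u) (vbar v)"
  "u \<in> vecs \<Longrightarrow> c \<in> carrier R \<Longrightarrow> vbar (vscale c u) = vscale (bar c) (vbar u)"
  "u \<in> vecs \<Longrightarrow> vbar u = vzero \<longleftrightarrow> u = vzero"
  by (cases u; cases v; simp)+

lemma vbar_nzvecs: "u \<in> nzvecs R \<Longrightarrow> vbar u \<in> nzvecs R"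
  by (simp add: nzvecs_eq)

lemma pspan_vbar_eq_iff:
  assumes "u \<in> nzvecs R" "v \<in> nzvecs R"
  shows "pspan R (vbar u) = pspan R (vbar v) \<longleftrightarrow> pspan R u = pspan R v"
proof -
  have "pspan R (vbar x) = pspan R (vbar y)"
    if x: "x \<in> nzvecs R" and y: "y \<in> nzvecs R" and eq: "pspan R x = pspan R y" for x y
  proof -
    obtain c where c: "c \<in> carrier R" "x = vscale c y"
      using pspan_eqD[OF nzvecs_vecs[OF x] eq] by blast
    then have "vbar x = vscale (bar c) (vbar y)"
      using nzvecs_vecs[OF y] by simp
    from pspan_eqI[OF vbar_nzvecs[OF x] _ _ this] show ?thesis
      using c(1) nzvecs_vecs[OF y] by simp
  qed
  from this[of u v] this[of "vbar u" "vbar v"] show ?thesis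
    using assms by (auto simp: vbar_nzvecs nzvecs_vecs)
qed

lemma bar_herm: "u \<in> vecs \<Longrightarrow> v \<in> vecs \<Longrightarrow> bar (herm u v) = herm v u"
  by (cases u; cases v) (simp add: herm_def m_comm)

lemma herm_eq_zero_commute:
  "u \<in> vecs \<Longrightarrow> v \<in> vecs \<Longrightarrow> herm u v = \<zero> \<Longrightarrow> herm v u = \<zero>"
  using bar_herm[of u v] by simp

lemma vdot_vbar: "u \<in> vecs \<Longrightarrow> v \<in> vecs \<Longrightarrow> vdot (vbar u) v = herm v u"
  by (simp add: herm_def vdot_commute)

lemma herm_simps [simp]:
  "u \<in> vecs \<Longrightarrow> v \<in> vecs \<Longrightarrow> herm u v \<in> carrier R"
  "u \<in> vecs \<Longrightarrow> v \<in> vecs \<Longrightarrow> w \<in> vecs \<Longrightarrow> herm (vadd u v) w = herm u w \<oplus> herm v w"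
  "u \<in> vecs \<Longrightarrow> v \<in> vecs \<Longrightarrow> w \<in> vecs \<Longrightarrow> herm w (vadd u v) = herm w u \<oplus> herm w v"
  "u \<in> vecs \<Longrightarrow> v \<in> vecs \<Longrightarrow> c \<in> carrier R \<Longrightarrow> herm (vscale c u) v = c \<otimes> herm u v"
  "u \<in> vecs \<Longrightarrow> v \<in> vecs \<Longrightarrow> c \<in> carrier R \<Longrightarrow> herm u (vscale c v) = bar c \<otimes> herm u v"
  by (simp_all add: herm_def)

lemma isotropicD:
  assumes "isotropic u"
  shows "u \<in> nzvecs R" "u \<in> vecs" "herm u u = \<zero>"
  using assms nzvecs_vecs by (auto simp: isotropic_def)

lemma isotropic_vscale:
  "isotropic u \<Longrightarrow> c \<in> carrier R \<Longrightarrow> c \<noteq> \<zero> \<Longrightarrow> isotropic (vscale c u)"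
  by (simp add: isotropic_def vscale_nzvecs nzvecs_vecs)

lemma herm_self:
  "x \<in> carrier R \<Longrightarrow> y \<in> carrier R \<Longrightarrow> z \<in> carrier R \<Longrightarrow>
    herm (x, y, z) (x, y, z) = field_norm x \<oplus> field_norm y \<oplus> field_norm z"
  by (simp add: herm_def field_norm_eq)

lemma hunital_eq: "hunital R q = pspan R ` Collect isotropic"
proof -
  have "isotropic (x, y, z) \<longleftrightarrow>
      (x, y, z) \<in> nzvecs R \<and> x [^] (q + 1) \<oplus> y [^] (q + 1) \<oplus> z [^] (q + 1) = \<zero>" for x y z
    using herm_self[of x y z] by (auto simp: isotropic_def nzvecs_eq field_norm_def simp del: nat_pow_Suc)
  then have "hunital R q = {pspan R (x, y, z) | x y z. isotropic (x, y, z)}"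
    unfolding hunital_def by simp
  then show ?thesis by auto
qed

lemma hunitalE:
  assumes "P \<in> hunital R q"
  obtains u where "isotropic u" "P = pspan R u"
  using assms unfolding hunital_eq by blast

lemma pspan_mem_hunital_iff:
  assumes "u \<in> nzvecs R"
  shows "pspan R u \<in> hunital R q \<longleftrightarrow> isotropic u"
proof
  assume "pspan R u \<in> hunital R q"
  then obtain v where v: "isotropic v" "pspan R u = pspan R v"
    by (rule hunitalE)
  then obtain c where "c \<in> carrier R" "c \<noteq> \<zero>" "u = vscale c v"
    using pspan_eqD[OF nzvecs_vecs[OF assms]] by blast
  then show "isotropic u"
    using isotropic_vscale v(1) by simp
qed (simp add: hunital_eq)

lemma card_field_norm_extension:
  fixes f :: "'s \<Rightarrow> 'a"
  assumes "finite S" and f: "\<And>s. s \<in> S \<Longrightarrow> f s \<in> carrier R" "\<And>s. s \<in> S \<Longrightarrow> bar (f s) = f s"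
  shows "card {(s, z). s \<in> S \<and> z \<in> carrier R \<and> f s \<oplus> field_norm z = \<zero>} + q * card {s \<in> S. f s = \<zero>} =
    (q + 1) * card S"
proof -
  let ?F = "\<lambda>s. {z \<in> carrier R. field_norm z = \<ominus> f s}"
  have "{(s, z). s \<in> S \<and> z \<in> carrier R \<and> f s \<oplus> field_norm z = \<zero>} = (SIGMA s:S. ?F s)"
    using f(1) by (auto simp: add_eq_zero_iff)
  then have "card {(s, z). s \<in> S \<and> z \<in> carrier R \<and> f s \<oplus> field_norm z = \<zero>} = (\<Sum>s\<in>S. card (?F s))"
    using assms(1) finite_carrier by (simp add: card_SigmaI)
  moreover have "card (?F s) + (if f s = \<zero> then q else 0) = q + 1" if "s \<in> S" for s
    using card_field_norm_fibre[of "\<ominus> f s"] f[OF that] add.inv_eq_1_iff[of "f s"] by simp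
  then have "(\<Sum>s\<in>S. card (?F s)) + (\<Sum>s\<in>S. if f s = \<zero> then q else 0) = (q + 1) * card S"
    by (simp flip: sum.distrib)
  moreover have "(\<Sum>s\<in>S. if f s = \<zero> then q else 0) = q * card {s \<in> S. f s = \<zero>}"
    using assms(1) by (simp add: sum.If_cases Int_def)
  ultimately show ?thesis by simp
qed

lemma card_isotropic_vecs:
  "card {u \<in> vecs. herm u u = \<zero>} + q ^ 3 = q ^ 5 + q ^ 2"
proof -
  let ?C = "carrier R" and ?N = field_norm
  let ?pairs = "{(x, y). x \<in> ?C \<and> y \<in> ?C \<and> ?N x \<oplus> ?N y = \<zero>}"
  let ?triples = "{(p, z). p \<in> ?C \<times> ?C \<and> z \<in> ?C \<and> ?N (fst p) \<oplus> ?N (snd p) \<oplus> ?N z = \<zero>}"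
  have "{x \<in> ?C. ?N x = \<zero>} = {\<zero>}" by auto
  then have pairs: "card ?pairs + q = (q + 1) * q ^ 2"
    using card_field_norm_extension[of ?C ?N] finite_carrier card_carrier by simp
  have "card (?C \<times> ?C) = q ^ 4"
    by (simp add: card_cartesian_product card_carrier flip: power_add)
  moreover have "{p \<in> ?C \<times> ?C. ?N (fst p) \<oplus> ?N (snd p) = \<zero>} = ?pairs" by auto
  ultimately have triples: "card ?triples + q * card ?pairs = (q + 1) * q ^ 4"
    using card_field_norm_extension[of "?C \<times> ?C" "\<lambda>p. ?N (fst p) \<oplus> ?N (snd p)"] finite_carrier
    by (simp add: mem_Times_iff)
  have "{u \<in> vecs. herm u u = \<zero>} = (\<lambda>((x, y), z). (x, y, z)) ` ?triples"
    by (auto simp: image_iff herm_self)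
  moreover have "inj_on (\<lambda>((x, y), z). (x, y, z)) ?triples"
    by (auto simp: inj_on_def)
  ultimately have "card {u \<in> vecs. herm u u = \<zero>} = card ?triples"
    by (simp only: card_image)
  then have "card {u \<in> vecs. herm u u = \<zero>} + q * (card ?pairs + q) = (q + 1) * q ^ 4 + q ^ 2"
    using triples by (simp add: algebra_simps power2_eq_square)
  then show ?thesis
    unfolding pairs by (simp add: algebra_simps eval_nat_numeral)
qed

lemma card_hunital: "card (hunital R q) = q ^ 3 + 1"
proof -
  have "(q ^ 2 - 1) * card (hunital R q) = card (Collect isotropic)"
    unfolding hunital_eq card_carrier[symmetric]
    by (rule card_pspan_image[OF finite_carrier]) (blast intro: isotropicD(1) isotropic_vscale)+
  also have "Collect isotropic = {u \<in> vecs. herm u u = \<zero>} - {vzero}"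
    by (auto simp: isotropic_def nzvecs_eq)
  also have "card \<dots> = card {u \<in> vecs. herm u u = \<zero>} - 1"
    by (rule card_Diff_singleton) (simp add: herm_def)
  also have "\<dots> = q ^ 5 + q ^ 2 - q ^ 3 - 1"
    using card_isotropic_vecs by simp
  also have "\<dots> = (q ^ 2 - 1) * (q ^ 3 + 1)"
    by (simp add: algebra_simps flip: power_add)
  finally have "(q ^ 2 - 1) * card (hunital R q) = (q ^ 2 - 1) * (q ^ 3 + 1)" .
  moreover have "q ^ 2 > 1" using q_ge_2 by (intro one_less_power) auto
  ultimately show ?thesis by (simp only: mult_cancel1) auto
qed

lemma herm_isotropic_nonzero:
  assumes u: "isotropic u" and v: "isotropic v" and neq: "pspan R u \<noteq> pspan R v"
  shows "herm u v \<noteq> \<zero>"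
proof
  assume "herm u v = \<zero>"
  note nz = isotropicD(1)[OF u] isotropicD(1)[OF v] and vecs = isotropicD(2)[OF u] isotropicD(2)[OF v]
  have "herm v u = \<zero>"
    using herm_eq_zero_commute vecs \<open>herm u v = \<zero>\<close> .
  have "pspan R (vbar x) = pspan R (vcross u v)" if "x \<in> {u, v}" for x
    using that u v vecs \<open>herm u v = \<zero>\<close> \<open>herm v u = \<zero>\<close>
    by (intro pspan_eq_vcross[OF nz neq] vbar_nzvecs) (auto simp: isotropicD vdot_vbar)
  then have "pspan R (vbar u) = pspan R (vbar v)"
    by simp
  then show False
    using pspan_vbar_eq_iff[OF nz] neq by simp
qed

lemma normalised_isotropic:
  assumes "P \<in> hunital R q" "d \<in> vecs" "P \<notin> pline R d"
  obtains u where "isotropic u" "P = pspan R u" "vdot d u = \<one>"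
proof -
  obtain w where w: "isotropic w" "P = pspan R w"
    using hunitalE[OF assms(1)] .
  then have c: "vdot d w \<in> carrier R" "vdot d w \<noteq> \<zero>"
    using assms mem_pline_iff isotropicD by auto
  show ?thesis
  proof (rule that[of "vscale (inv (vdot d w)) w"])
    show "isotropic (vscale (inv (vdot d w)) w)"
      using w(1) c by (intro isotropic_vscale) auto
    show "P = pspan R (vscale (inv (vdot d w)) w)"
      using w c isotropicD(2) by (simp add: pspan_vscale)
    show "vdot d (vscale (inv (vdot d w)) w) = \<one>"
      using w(1) c assms(2) isotropicD(2) by simp
  qed
qed

lemma herm_affine_point:
  assumes "isotropic u" "isotropic v" "t \<in> carrier R"
  shows "herm (affine_point u v t) (affine_point u v t) = t \<otimes> herm v u \<oplus> bar t \<otimes> herm u v"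
  using assms by (simp add: isotropicD)

lemma hyperbolic_pair:
  assumes "P \<in> hunital R q" "Q \<in> hunital R q" "P \<noteq> Q"
  obtains u v where "isotropic u" "isotropic v" "P = pspan R u" "Q = pspan R v" "herm u v = \<one>" "herm v u = \<one>"
proof -
  obtain u w where u: "isotropic u" "P = pspan R u" and w: "isotropic w" "Q = pspan R w"
    using hunitalE assms(1,2) by metis
  have "herm w u \<noteq> \<zero>"
    using herm_isotropic_nonzero[OF w(1) u(1)] u(2) w(2) assms(3) by simp
  then have "Q \<notin> pline R (vbar u)"
    using u w by (simp add: isotropicD mem_pline_iff vdot_vbar)
  then obtain v where v: "isotropic v" "Q = pspan R v" "vdot (vbar u) v = \<one>"
    using normalised_isotropic[OF assms(2)] isotropicD(2)[OF u(1)] by (metis vbar_simps(1))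
  then have "herm v u = \<one>"
    using u(1) by (simp add: isotropicD vdot_vbar)
  moreover from this have "herm u v = \<one>"
    using bar_herm[of v u] u(1) v(1) by (simp add: isotropicD)
  ultimately show ?thesis
    using that u v by blast
qed

lemma card_pline_Int_hunital:
  assumes "l \<in> plines R" and P: "P \<in> l" "P \<in> hunital R q" and Q: "Q \<in> l" "Q \<in> hunital R q" and "P \<noteq> Q"
  shows "card (l \<inter> hunital R q) = q + 1"
proof -
  obtain u v where u: "isotropic u" "P = pspan R u" and v: "isotropic v" "Q = pspan R v"
    and herm: "herm u v = \<one>" "herm v u = \<one>"
    using hyperbolic_pair[OF P(2) Q(2) \<open>P \<noteq> Q\<close>] by metis
  let ?point = "\<lambda>t. pspan R (affine_point u v t)" and ?T = "{t \<in> carrier R. t \<oplus> bar t = \<zero>}"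
  have uv: "u \<in> nzvecs R" "v \<in> nzvecs R" "pspan R u \<noteq> pspan R v"
    using u v \<open>P \<noteq> Q\<close> by (auto simp: isotropicD)
  have "?point t \<in> hunital R q \<longleftrightarrow> t \<oplus> bar t = \<zero>" if "t \<in> carrier R" for t
    using herm_affine_point[OF u(1) v(1) that] affine_point_nzvecs[OF uv that] that herm
    by (simp add: pspan_mem_hunital_iff isotropic_def)
  moreover have "l = insert (pspan R v) (?point ` carrier R)"
    using plines_eq_pline_vcross[OF uv assms(1)] pline_vcross_eq[OF uv] P(1) Q(1) u(2) v(2) by simp
  ultimately have "l \<inter> hunital R q = insert (pspan R v) (?point ` ?T)"
    using Q(2) v(2) by auto
  moreover have "pspan R v \<notin> ?point ` ?T"
    using pspan_neq_affine_point[OF uv] by blast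
  moreover have "inj_on ?point ?T"
    by (rule inj_on_subset[OF inj_on_affine_points[OF uv]]) auto
  ultimately show ?thesis
    using finite_carrier by (simp add: card_image card_trace_zero)
qed

lemma secants_plines: "l \<in> secants R q \<Longrightarrow> l \<in> plines R"
  by (simp add: secants_def)

sublocale steiner_system "hunital R q" "secants R q" "q + 1"
proof
  show "finite (hunital R q)"
    using card_hunital by (intro card_ge_0_finite) simp
  have "finite (nzvecs R)"
    using finite_carrier by (simp add: nzvecs_eq vecs_def)
  then show "finite (secants R q)"
    by (simp add: secants_def plines_def)
next
  fix l assume "l \<in> secants R q"
  then show "card (hunital R q \<inter> l) = q + 1"
    by (simp add: secants_def Int_commute)
next
  fix P Q assume P: "P \<in> hunital R q" and Q: "Q \<in> hunital R q" and neq: "P \<noteq> Q"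
  then obtain u v where u: "u \<in> nzvecs R" "P = pspan R u" and v: "v \<in> nzvecs R" "Q = pspan R v"
    using hunitalE isotropicD(1) by metis
  let ?l = "pline R (vcross u v)"
  have "?l \<in> plines R" "P \<in> ?l" "Q \<in> ?l"
    using vcross_nzvecs[OF u(1) v(1)] pline_vcross_mem[OF u(1) v(1)] u v neq by (auto simp: plines_def)
  moreover from this have "?l \<in> secants R q"
    using card_pline_Int_hunital P Q neq by (simp add: secants_def)
  ultimately show "\<exists>!l. l \<in> secants R q \<and> P \<in> l \<and> Q \<in> l"
    using plines_eqI[OF secants_plines secants_plines _ _ neq] by blast
qed

lemma card_secants: "card (secants R q) = q ^ 4 - q ^ 3 + q ^ 2"
proof -
  have "card (secants R q) * (2 * (q + 1 choose 2)) = 2 * (q ^ 3 + 1 choose 2)"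
    using card_blocks card_hunital by simp
  then have "card (secants R q) * ((q + 1) * q) = (q ^ 3 + 1) * q ^ 3"
    by (simp add: times_binomial_minus1_eq)
  also have "\<dots> = (q ^ 4 - q ^ 3 + q ^ 2) * ((q + 1) * q)"
    by (simp add: algebra_simps eval_nat_numeral)
  finally show ?thesis
    using q_ge_2 by (simp only: mult_cancel2) auto
qed

section \<open>Triangles of secants\<close>

lemma meet_eq_iff:
  assumes "l \<in> secants R q" "m \<in> secants R q" "l \<noteq> m"
  shows "meet l m = P \<longleftrightarrow> P \<in> l \<inter> m"
proof -
  obtain Q where "l \<inter> m = {Q}"
    using plines_meet[OF secants_plines[OF assms(1)] secants_plines[OF assms(2)] assms(3)] .
  then show ?thesis by (auto simp: meet_def)
qed

lemma Hadj_iff: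
  assumes "l \<in> secants R q" "m \<in> secants R q"
  shows "Hadj R q l m \<longleftrightarrow> l \<noteq> m \<and> hunital R q \<inter> l \<inter> m \<noteq> {}"
proof (cases "l = m")
  case False
  have "meet l m \<in> hunital R q \<longleftrightarrow> (\<exists>P. meet l m = P \<and> P \<in> hunital R q)" by simp
  also have "\<dots> \<longleftrightarrow> hunital R q \<inter> l \<inter> m \<noteq> {}"
    unfolding meet_eq_iff[OF assms False] by blast
  finally show ?thesis
    using False by (simp add: Hadj_def)
qed (simp add: Hadj_def)

lemma triple_in_triangles_iff_meets:
  "{l, m, n} \<in> triangles \<longleftrightarrow>
    l \<in> secants R q \<and> m \<in> secants R q \<and> n \<in> secants R q \<and>
    Hadj R q l m \<and> Hadj R q m n \<and> Hadj R q l n \<and>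
    meet l m \<noteq> meet m n \<and> meet l m \<noteq> meet l n \<and> meet m n \<noteq> meet l n"
proof (cases "l \<in> secants R q \<and> m \<in> secants R q \<and> n \<in> secants R q \<and>
    Hadj R q l m \<and> Hadj R q m n \<and> Hadj R q l n")
  case True
  then have sec: "l \<in> secants R q" "m \<in> secants R q" "n \<in> secants R q"
    and adj: "Hadj R q l m" "Hadj R q m n" "Hadj R q l n" by blast+
  then have neq: "l \<noteq> m" "m \<noteq> n" "l \<noteq> n" by (simp_all add: Hadj_def)
  note mem = meet_eq_iff[OF sec(1,2) neq(1)] meet_eq_iff[OF sec(2,3) neq(2)] meet_eq_iff[OF sec(1,3) neq(3)]
  have "hunital R q \<inter> l \<inter> m \<inter> n \<noteq> {} \<longleftrightarrow> meet l m \<in> n"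
  proof
    assume "hunital R q \<inter> l \<inter> m \<inter> n \<noteq> {}"
    then obtain P where "P \<in> l \<inter> m" "P \<in> n" by blast
    then show "meet l m \<in> n" using mem(1)[of P] by simp
  next
    assume "meet l m \<in> n"
    then show "hunital R q \<inter> l \<inter> m \<inter> n \<noteq> {}"
      using mem(1)[of "meet l m"] adj(1) by (auto simp: Hadj_def)
  qed
  moreover have "meet l m \<in> n \<longleftrightarrow> meet l m = meet m n" "meet l m \<in> n \<longleftrightarrow> meet l m = meet l n"
    "meet m n = meet l n \<longrightarrow> meet l m \<in> n"
    using mem by (metis IntI IntD1 IntD2)+
  moreover have "{l, m, n} \<in> triangles \<longleftrightarrow> hunital R q \<inter> l \<inter> m \<inter> n = {}"
    using sec adj neq by (simp add: triple_in_triangles_iff Hadj_iff)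
  ultimately have "{l, m, n} \<in> triangles \<longleftrightarrow>
      meet l m \<noteq> meet m n \<and> meet l m \<noteq> meet l n \<and> meet m n \<noteq> meet l n"
    by metis
  with True show ?thesis by simp
next
  case False
  then show ?thesis
    using Hadj_iff by (auto simp: triple_in_triangles_iff)
qed

lemma Htri_eq: "Htri R q = triangles"
proof -
  have "t \<in> Htri R q \<longleftrightarrow> (\<exists>l m n. t = {l, m, n} \<and> {l, m, n} \<in> triangles)" for t
    by (simp add: Htri_def triple_in_triangles_iff_meets)
  then show ?thesis
    by (metis triangleE subsetI equalityI)
qed

lemma herm_skew_if_meet:
  assumes u: "isotropic u" "pspan R u \<in> l" "vdot d u = \<one>"
    and v: "isotropic v" "pspan R v \<in> l" "vdot d v = \<one>"
    and neq: "pspan R u \<noteq> pspan R v" and l: "l \<in> plines R" and d: "d \<in> vecs"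
    and P: "P \<in> hunital R q" "P \<in> l" "P \<in> pline R d"
  shows "herm v u = \<ominus> herm u v"
proof -
  have uv: "u \<in> nzvecs R" "v \<in> nzvecs R" "pspan R u \<noteq> pspan R v" "u \<in> vecs" "v \<in> vecs"
    using u v neq by (simp_all add: isotropicD)
  have "P \<noteq> pspan R v"
    using P(3) v(3) mem_pline_iff[OF d uv(2)] by auto
  then obtain t where t: "t \<in> carrier R" "P = pspan R (affine_point u v t)"
    using plines_eq_pline_vcross[OF uv(1-3) l u(2) v(2)] pline_vcross_eq[OF uv(1-3)] P(2) by auto
  have "vdot d (affine_point u v t) = \<zero>" "isotropic (affine_point u v t)"
    using affine_point_nzvecs[OF uv(1-3) t(1)] P t(2) mem_pline_iff[OF d] pspan_mem_hunital_iff by auto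
  then have "\<one> \<oplus> t = \<zero>" and iso: "t \<otimes> herm v u \<oplus> bar t \<otimes> herm u v = \<zero>"
    using herm_affine_point[OF u(1) v(1) t(1)] isotropicD(3) t(1) u(3) v(3) d uv by simp_all
  then have "t = \<ominus> \<one>"
    using t(1) by (simp add: add_eq_zero_iff)
  with iso have "\<ominus> herm v u \<oplus> \<ominus> herm u v = \<zero>"
    using uv by (simp add: l_minus)
  then show ?thesis
    using uv by (simp add: add_eq_zero_iff)
qed

text \<open>An alternating matrix of odd size is singular; the kernel vector is explicit for size three.\<close>

lemma alternating_gram_collinear:
  assumes iso: "isotropic u" "isotropic v" "isotropic w" and neq: "pspan R u \<noteq> pspan R v"
    and skew: "herm v u = \<ominus> herm u v" "herm w v = \<ominus> herm v w" "herm u w = \<ominus> herm w u"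
  obtains l where "l \<in> nzvecs R" "vdot l u = \<zero>" "vdot l v = \<zero>" "vdot l w = \<zero>"
proof -
  note vecs = iso[THEN isotropicD(2)]
  define x where "x = vadd (vscale (herm v w) u) (vadd (vscale (herm w u) v) (vscale (herm u v) w))"
  have x: "x \<in> vecs" using vecs by (simp add: x_def)
  have "herm x u = \<zero>" "herm x v = \<zero>" "herm x w = \<zero>"
    unfolding x_def using vecs iso[THEN isotropicD(3)] by (simp_all add: skew l_minus r_minus m_comm l_neg r_neg)
  then have perp: "vdot (vbar x) u = \<zero>" "vdot (vbar x) v = \<zero>" "vdot (vbar x) w = \<zero>"
    using vecs x by (simp_all add: vdot_vbar herm_eq_zero_commute)
  show ?thesis
  proof (cases "x = vzero")
    case False
    then have "vbar x \<in> nzvecs R" using x by (simp add: nzvecs_eq)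
    then show ?thesis using that perp by blast
  next
    case True
    have "vdot (vcross u v) x = herm u v \<otimes> vdot (vcross u v) w"
      using vecs by (simp add: x_def)
    then have "herm u v \<otimes> vdot (vcross u v) w = \<zero>"
      using True vecs by simp
    then have "vdot (vcross u v) w = \<zero>"
      using herm_isotropic_nonzero[OF iso(1,2) neq] vecs by (simp add: integral_iff)
    then show ?thesis
      using that vcross_nzvecs[OF iso(1,2)[THEN isotropicD(1)] neq] vecs by simp
  qed
qed

lemma collinear_if_transversal:
  assumes lines: "a \<in> plines R" "b \<in> plines R" "c \<in> plines R" "d \<in> plines R"
    and vertices: "A \<in> hunital R q \<inter> b \<inter> c" "B \<in> hunital R q \<inter> c \<inter> a" "C \<in> hunital R q \<inter> a \<inter> b"
    and neq: "A \<noteq> B" "B \<noteq> C" "C \<noteq> A" and off: "A \<notin> d" "B \<notin> d" "C \<notin> d"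
    and transversal: "hunital R q \<inter> a \<inter> d \<noteq> {}" "hunital R q \<inter> b \<inter> d \<noteq> {}" "hunital R q \<inter> c \<inter> d \<noteq> {}"
  obtains l where "l \<in> plines R" "A \<in> l" "B \<in> l" "C \<in> l"
proof -
  obtain k where k: "k \<in> vecs" "d = pline R k"
    using lines(4) nzvecs_vecs unfolding plines_def by blast
  obtain u v w where u: "isotropic u" "A = pspan R u" "vdot k u = \<one>"
    and v: "isotropic v" "B = pspan R v" "vdot k v = \<one>"
    and w: "isotropic w" "C = pspan R w" "vdot k w = \<one>"
    using normalised_isotropic[OF _ k(1)] vertices off k(2) by (metis IntD1)
  obtain A' B' C' where "A' \<in> hunital R q" "A' \<in> a" "A' \<in> d" "B' \<in> hunital R q" "B' \<in> b" "B' \<in> d"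
    "C' \<in> hunital R q" "C' \<in> c" "C' \<in> d"
    using transversal by blast
  then have "herm v u = \<ominus> herm u v" "herm w v = \<ominus> herm v w" "herm u w = \<ominus> herm w u"
    using herm_skew_if_meet[of u c k v C'] herm_skew_if_meet[of v a k w A'] herm_skew_if_meet[of w b k u B']
      u v w neq lines k vertices by simp_all
  then obtain l where l: "l \<in> nzvecs R" "vdot l u = \<zero>" "vdot l v = \<zero>" "vdot l w = \<zero>"
    using alternating_gram_collinear u(1) v(1) w(1) neq(1) u(2) v(2) by metis
  then have "pline R l \<in> plines R" "A \<in> pline R l" "B \<in> pline R l" "C \<in> pline R l"
    using u v w by (simp_all add: plines_def mem_pline_iff nzvecs_vecs isotropicD)
  then show ?thesis by (rule that)
qed

theorem no_onan_configuration:
  assumes "{a, b, c} \<in> triangles" "{a, b, d} \<in> triangles" "{a, c, d} \<in> triangles"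
  shows "{b, c, d} \<notin> triangles"
proof
  let ?U = "hunital R q"
  assume "{b, c, d} \<in> triangles"
  note quadrangle = assms this
  have lines: "a \<in> plines R" "b \<in> plines R" "c \<in> plines R" "d \<in> plines R"
    using quadrangle secants_plines by (simp_all add: triple_in_triangles_iff)
  have meets: "?U \<inter> b \<inter> c \<noteq> {}" "?U \<inter> a \<inter> c \<noteq> {}" "?U \<inter> a \<inter> b \<noteq> {}"
    and transversal: "?U \<inter> a \<inter> d \<noteq> {}" "?U \<inter> b \<inter> d \<noteq> {}" "?U \<inter> c \<inter> d \<noteq> {}"
    and not_concurrent: "?U \<inter> a \<inter> b \<inter> c = {}" "?U \<inter> a \<inter> b \<inter> d = {}" "?U \<inter> a \<inter> c \<inter> d = {}" "?U \<inter> b \<inter> c \<inter> d = {}"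
    using quadrangle by (simp_all add: triple_in_triangles_iff)
  obtain A B C where vertices: "A \<in> ?U \<inter> b \<inter> c" "B \<in> ?U \<inter> c \<inter> a" "C \<in> ?U \<inter> a \<inter> b"
    using meets by blast
  then have neq: "A \<noteq> B" "B \<noteq> C" "C \<noteq> A" and off: "A \<notin> d" "B \<notin> d" "C \<notin> d"
    using not_concurrent by blast+
  obtain l where l: "l \<in> plines R" "A \<in> l" "B \<in> l" "C \<in> l"
    using collinear_if_transversal[OF lines vertices neq off transversal] .
  then have "l = c"
    using plines_eqI[OF l(1) lines(3), of A B] vertices neq(1) by blast
  then show False
    using l(4) vertices(3) not_concurrent(1) by blast
qed

theorem card_monochromatic_Htri_ge:
  "(1 / 4 - 3 / (4 * real q)) * real (card (Htri R q)) \<le> real (card {t \<in> Htri R q. monochromatic col t})"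
proof -
  let ?M = "{t \<in> triangles. monochromatic col t}" and ?N = "{t \<in> triangles. \<not> monochromatic col t}"
  have "triangles = ?M \<union> ?N" by blast
  then have "card triangles = card ?M + card ?N"
    using card_Un_disjoint[of ?M ?N] finite_triangles by auto
  moreover have "real (4 * q * card ?N) \<le> real (3 * (q + 1) * card triangles)"
    using card_not_monochromatic_triangles_le[of col] by (simp only: of_nat_le_iff) simp
  ultimately have "(real q - 3) * real (card triangles) \<le> 4 * real q * real (card ?M)"
    by (simp add: algebra_simps)
  then show ?thesis
    unfolding Htri_eq using q_ge_2 by (simp add: field_simps)
qed

lemma card_Htri_pos: "card (Htri R q) > 0"
proof -
  have "card (secants R q) > 0"
    unfolding card_secants using q_ge_2 by (intro add_nonneg_pos) auto
  moreover have "q < q ^ 3"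
    using q_ge_2 power_strict_increasing[of 1 3 q] by simp
  ultimately have "card (secants R q) * (card (hunital R q) - (q + 1)) * ((q + 1) * q) > 0"
    using q_ge_2 by (simp add: card_hunital)
  then show ?thesis
    using card_triangles Htri_eq by (intro gr0I) simp
qed

theorem quasi_folkman_secants:
  assumes "q \<ge> 4"
  shows "quasi_folkman_with (secants R q) (Hadj R q) (Htri R q)"
  unfolding quasi_folkman_with_def
proof (intro conjI allI ballI)
  fix t assume "t \<in> Htri R q"
  then obtain l m n where "t = {l, m, n}" "{l, m, n} \<in> triangles"
    unfolding Htri_eq by (metis triangleE)
  then show "is_triangle (secants R q) (Hadj R q) t"
    unfolding is_triangle_def triple_in_triangles_iff_meets
    by (intro exI[of _ l] exI[of _ m] exI[of _ n]) (simp add: Hadj_def)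
next
  fix col :: "('a \<times> 'a \<times> 'a) set set set \<Rightarrow> bool"
  have "0 < (1 / 4 - 3 / (4 * real q)) * real (card (Htri R q))"
    using assms card_Htri_pos by (simp add: field_simps)
  also have "\<dots> \<le> real (card {t \<in> Htri R q. monochromatic col t})"
    by (rule card_monochromatic_Htri_ge)
  finally have "{t \<in> Htri R q. monochromatic col t} \<noteq> {}"
    by (metis card.empty less_irrefl of_nat_0)
  then show "\<exists>t\<in>Htri R q. monochromatic col t" by blast
qed (use no_onan_configuration Htri_eq in blast)

end

theorem theorem1:
  shows "(\<forall>q (R :: 'a ring). is_prime_power q \<and> q \<ge> 4 \<and> field R \<and> finite (carrier R) \<and>
            card (carrier R) = q ^ 2 \<longrightarrow>
            card (secants R q) = q ^ 4 - q ^ 3 + q ^ 2 \<and>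
            quasi_folkman_with (secants R q) (Hadj R q) (Htri R q))
       \<and> (\<forall>\<epsilon> :: real. \<epsilon> > 0 \<longrightarrow> (\<exists>Q :: nat. \<forall>q (R :: 'a ring) (col :: ('a \<times> 'a \<times> 'a) set set set \<Rightarrow> bool).
            is_prime_power q \<and> q \<ge> Q \<and> field R \<and> finite (carrier R) \<and> card (carrier R) = q ^ 2 \<longrightarrow>
            real (card {t \<in> Htri R q. monochromatic col t}) \<ge> (1 / 4 - \<epsilon>) * real (card (Htri R q))))"
proof (intro conjI allI impI)
  fix q and R :: "'a ring"
  assume params: "is_prime_power q \<and> q \<ge> 4 \<and> field R \<and> finite (carrier R) \<and> card (carrier R) = q ^ 2"
  then interpret hermitian_plane R q
    by (simp add: hermitian_plane_def hermitian_plane_axioms_def)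
  show "card (secants R q) = q ^ 4 - q ^ 3 + q ^ 2" by (rule card_secants)
  show "quasi_folkman_with (secants R q) (Hadj R q) (Htri R q)" using quasi_folkman_secants params by blast
next
  fix \<epsilon> :: real assume "\<epsilon> > 0"
  show "\<exists>Q :: nat. \<forall>q (R :: 'a ring) (col :: ('a \<times> 'a \<times> 'a) set set set \<Rightarrow> bool).
            is_prime_power q \<and> q \<ge> Q \<and> field R \<and> finite (carrier R) \<and> card (carrier R) = q ^ 2 \<longrightarrow>
            real (card {t \<in> Htri R q. monochromatic col t}) \<ge> (1 / 4 - \<epsilon>) * real (card (Htri R q))"
  proof (intro exI allI impI)
    fix q and R :: "'a ring" and col :: "('a \<times> 'a \<times> 'a) set set set \<Rightarrow> bool"
    assume params: "is_prime_power q \<and> q \<ge> nat \<lceil>1 / \<epsilon>\<rceil> \<and> field R \<and> finite (carrier R) \<and> card (carrier R) = q ^ 2"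
    then interpret hermitian_plane R q
      by (simp add: hermitian_plane_def hermitian_plane_axioms_def)
    have "1 / \<epsilon> \<le> real q" using params by linarith
    then have "1 / 4 - \<epsilon> \<le> 1 / 4 - 3 / (4 * real q)"
      using \<open>\<epsilon> > 0\<close> q_ge_2 by (simp add: field_simps)
    then show "real (card {t \<in> Htri R q. monochromatic col t}) \<ge> (1 / 4 - \<epsilon>) * real (card (Htri R q))"
      using card_monochromatic_Htri_ge[of col] by (meson mult_right_mono of_nat_0_le_iff order_trans)
  qed
qed

end
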